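(* Let $m\ge 1$ be an integer, let $\mathbf{A}$ be the deformed quon algebra acting on the vector space $\mathbf{V}$ with vacuum vector $|0\rangle$, and let $\mathbf{H}=\{a|0\rangle : a\in\mathbf{A}\}\subseteq\mathbf{V}$. Then $\mathbf{H}$ is a Hilbert space for the bilinear form $(.,.):\mathbf{H}\times\mathbf{H}\to\mathbb{R}(q)$ defined by $$\big(a|0\rangle,\, b|0\rangle\big) := \langle 0|\,a^{\dag}\, b\,|0\rangle \quad\text{with}\quad \langle 0|0\rangle=1,$$ and for $$-1<q<1\ \text{ if } m=1,\qquad\text{and}\qquad \frac{1}{1-m}<q<1\ \text{ if } m>1.$$
   Context: Notation: $\mathbb{N}^*=\{1,2,3,\dots\}$, $[m]=\{1,\dots,m\}$, and $\mathbb{R}(q)$ is the fraction field of the real polynomials in the variable $q$. For $k,l\in[m]$ put $\beta_{-k,l}=0$ if $l-k\equiv m \pmod m$ and $\beta_{-k,l}=1$ otherwise; $\delta_{i,j}$ is the Kronecker delta. The deformed quon algebra $\mathbf{A}$ is the free algebra $\mathbb{R}(q)\big[a_{i,k} : (i,k)\in\mathbb{N}^*\times[m]\big]$ subject to the anti-involution $\dag$ exchanging $a_{i,k}$ with $a_{i,k}^{\dag}$ (so the $a_{i,k}^{\dag}$ also belong to $\mathbf{A}$), and to the commutation relations $$a_{j,l}\,a_{i,k}^{\dag}=q\,a_{i,k}^{\dag}\,a_{j,l}+q^{\beta_{-k,l}}\,\delta_{i,j}\qquad\text{for all }(i,k),(j,l)\in\mathbb{N}^*\times[m].$$ Fock-like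 representation: the generators of $\mathbf{A}$ are linear operators $a_{i,k},a_{i,k}^{\dag}:\mathbf{V}\to\mathbf{V}$ on an infinite dimensional real vector space $\mathbf{V}$ satisfying these commutation relations and the relations $a_{i,k}|0\rangle=0$ for all $(i,k)$, where $a_{i,k}^{\dag}$ is the adjoint of $a_{i,k}$ and $|0\rangle$ is a nonzero distinguished vector of $\mathbf{V}$. The expression $\langle 0|\,x\,|0\rangle$, for $x\in\mathbf{A}$, is the vacuum expectation of $x$; it is linear in $x$ and is computed from $\langle 0|0\rangle=1$, $a_{i,k}|0\rangle=0$ and $\langle 0|a_{i,k}^{\dag}=0$.
   Formalization: H has countably infinite dimension, so it is never complete: proved instead is that (.,.) is an inner product on H, whose completion is the Hilbert space ℓ². The R(q)-valued form is not well defined on real V, so it is evaluated at the real q, for a, b with coefficients having no pole at q. *)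

theory Defs
  imports
    "HOL-Analysis.Analysis"
    "HOL-Library.Poly_Mapping"
    "HOL-Number_Theory.Cong"
    "HOL-Computational_Algebra.Polynomial"
    "HOL-Computational_Algebra.Fraction_Field"
begin

section \<open>The field R(q) and specialization of q to a real number\<close>

type_synonym Rq = "real poly fract"

definition qvar :: Rq where
  "qvar = Fract [:0, 1:] 1"

definition regular_at :: "real \<Rightarrow> Rq \<Rightarrow> bool" where
  "regular_at q r \<longleftrightarrow> (\<exists>n d. r = Fract n d \<and> poly d q \<noteq> 0)"

text \<open>Evaluation of a rational function at \<open>q\<close>; only meaningful if there is no pole at \<open>q\<close>,
  in which case the value does not depend on the chosen fraction (see \<open>eval_at_Fract\<close>).\<close>

definition eval_at :: "real \<Rightarrow> Rq \<Rightarrow> real" where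
  "eval_at q r = (THE c. \<exists>n d. r = Fract n d \<and> poly d q \<noteq> 0 \<and> c = poly n q / poly d q)"

lemma eval_at_Fract:
  assumes "poly d q \<noteq> 0"
  shows "eval_at q (Fract n d) = poly n q / poly d q"
  unfolding eval_at_def
proof (rule the_equality)
  show "\<exists>n' d'. Fract n d = Fract n' d' \<and> poly d' q \<noteq> 0 \<and> poly n q / poly d q = poly n' q / poly d' q"
    using assms by blast
next
  fix c assume "\<exists>n' d'. Fract n d = Fract n' d' \<and> poly d' q \<noteq> 0 \<and> c = poly n' q / poly d' q"
  then obtain n' d' where *: "Fract n d = Fract n' d'" "poly d' q \<noteq> 0" "c = poly n' q / poly d' q"
    by blast
  have "d \<noteq> 0" "d' \<noteq> 0" using assms *(2) by auto
  then have "n * d' = n' * d" using *(1) by (simp add: eq_fract)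
  then have "poly n q * poly d' q = poly n' q * poly d q" by (simp flip: poly_mult)
  then show "c = poly n q / poly d q" using assms *(2) unfolding *(3) by (simp add: frac_eq_eq)
qed


section \<open>The deformed quon algebra\<close>

instantiation list :: (type) monoid_add
begin
definition zero_list :: "'a list" where "zero_list = []"
definition plus_list :: "'a list \<Rightarrow> 'a list \<Rightarrow> 'a list" where "plus_list = (@)"
instance by standard (simp_all add: zero_list_def plus_list_def)
end

text \<open>\<open>Ann i k\<close> and \<open>Cre i k\<close> stand for $a_{i,k}$ and $a_{i,k}^\dagger$. Words form a monoid under
  concatenation (written additively, as required by the type of polynomial mappings), so that the
  convolution product makes \<open>quon_poly\<close> the ring of noncommutative polynomials over R(q).\<close>

datatype quon_gen = Ann nat nat | Cre nat nat

type_synonym quon_poly = "quon_gen list \<Rightarrow>\<^sub>0 Rq"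

definition gen_indices :: "nat \<Rightarrow> (nat \<times> nat) set" where
  "gen_indices m = {1..} \<times> {1..m}"

definition quon_gens :: "nat \<Rightarrow> quon_gen set" where
  "quon_gens m = (\<Union>(i, k)\<in>gen_indices m. {Ann i k, Cre i k})"

definition free_alg :: "nat \<Rightarrow> quon_poly set" where
  "free_alg m = {x. Poly_Mapping.keys x \<subseteq> lists (quon_gens m)}"

definition scal :: "Rq \<Rightarrow> quon_poly" where
  "scal c = Poly_Mapping.single [] c"

definition gen :: "quon_gen \<Rightarrow> quon_poly" where
  "gen g = Poly_Mapping.single [g] 1"

fun dag_gen :: "quon_gen \<Rightarrow> quon_gen" where
  "dag_gen (Ann i k) = Cre i k"
| "dag_gen (Cre i k) = Ann i k"

text \<open>The anti-involution: linear over R(q), reversing words and exchanging the generators.\<close>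

definition dag :: "quon_poly \<Rightarrow> quon_poly" where
  "dag x = (\<Sum>w\<in>Poly_Mapping.keys x.
     Poly_Mapping.single (rev (map dag_gen w)) (Poly_Mapping.lookup x w))"

text \<open>\<open>qbeta m k l\<close> is $\beta_{-k,l}$.\<close>

definition qbeta :: "nat \<Rightarrow> nat \<Rightarrow> nat \<Rightarrow> nat" where
  "qbeta m k l = (if [int l - int k = int m] (mod int m) then 0 else 1)"

definition relator :: "nat \<Rightarrow> nat \<times> nat \<Rightarrow> nat \<times> nat \<Rightarrow> quon_poly" where
  "relator m = (\<lambda>(i, k) (j, l).
     gen (Ann j l) * gen (Cre i k)
     - (scal qvar * gen (Cre i k) * gen (Ann j l)
        + scal (qvar ^ qbeta m k l * (if i = j then 1 else 0))))"

text \<open>The two-sided ideal generated by the relators. The deformed quon algebra \<open>A\<close> is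
  \<open>free_alg m\<close> modulo \<open>quon_ideal m\<close>; its elements are handled through representatives
  in \<open>free_alg m\<close>.\<close>

inductive_set quon_ideal :: "nat \<Rightarrow> quon_poly set" for m where
  zero: "0 \<in> quon_ideal m"
| add: "\<lbrakk>x \<in> quon_ideal m; u \<in> free_alg m; v \<in> free_alg m;
         s \<in> gen_indices m; t \<in> gen_indices m\<rbrakk>
        \<Longrightarrow> x + u * relator m s t * v \<in> quon_ideal m"


section \<open>Vacuum expectation\<close>

text \<open>\<open>\<phi> x\<close> plays the role of $\langle 0|x|0\rangle$. Vanishing on the ideal says that \<open>\<phi>\<close> is a functional
  on \<open>A\<close>. Extensionality fixes the irrelevant values outside \<open>free_alg m\<close>, so that
  there is at most one such function.\<close>

definition is_vacuum_expectation :: "nat \<Rightarrow> (quon_poly \<Rightarrow> Rq) \<Rightarrow> bool" where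
  "is_vacuum_expectation m \<phi> \<longleftrightarrow>
     \<phi> \<in> extensional (free_alg m) \<and>
     (\<forall>x\<in>free_alg m. \<forall>y\<in>free_alg m. \<phi> (x + y) = \<phi> x + \<phi> y) \<and>
     (\<forall>c. \<forall>x\<in>free_alg m. \<phi> (scal c * x) = c * \<phi> x) \<and>
     (\<forall>x\<in>quon_ideal m. \<phi> x = 0) \<and>
     \<phi> 1 = 1 \<and>
     (\<forall>(i, k)\<in>gen_indices m. \<forall>x\<in>free_alg m. \<phi> (x * gen (Ann i k)) = 0) \<and>
     (\<forall>(i, k)\<in>gen_indices m. \<forall>x\<in>free_alg m. \<phi> (gen (Cre i k) * x) = 0)"

definition vac_exp :: "nat \<Rightarrow> quon_poly \<Rightarrow> Rq" where
  "vac_exp m = (THE \<phi>. is_vacuum_expectation m \<phi>)"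


section \<open>Fock-like representations at a real value of q\<close>

text \<open>The vector space \<open>V\<close> is the type \<open>'v\<close>; \<open>ann i k\<close>, \<open>cre i k\<close> are the operators $a_{i,k}$,
  $a_{i,k}^\dagger$ on it and \<open>vac\<close> is $|0\rangle$. No form on \<open>V\<close> is given: that \<open>cre i k\<close> is the
  adjoint of \<open>ann i k\<close> refers to the form \<open>(a|0>, b|0>) = <0|dag a b|0>\<close>, for which it holds by
  construction.\<close>

definition fock_like_rep ::
  "real \<Rightarrow> nat \<Rightarrow> (nat \<Rightarrow> nat \<Rightarrow> 'v \<Rightarrow> 'v) \<Rightarrow> (nat \<Rightarrow> nat \<Rightarrow> 'v \<Rightarrow> 'v) \<Rightarrow> 'v::real_vector \<Rightarrow> bool" where
  "fock_like_rep q m ann cre vac \<longleftrightarrow>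
     \<not> (\<exists>B::'v set. finite B \<and> span B = UNIV) \<and>
     (\<forall>(i, k)\<in>gen_indices m. linear (ann i k) \<and> linear (cre i k)) \<and>
     (\<forall>(i, k)\<in>gen_indices m. \<forall>(j, l)\<in>gen_indices m. \<forall>v.
        ann j l (cre i k v) =
          q *\<^sub>R cre i k (ann j l v) + (q ^ qbeta m k l * (if i = j then 1 else 0)) *\<^sub>R v) \<and>
     (\<forall>(i, k)\<in>gen_indices m. ann i k vac = 0) \<and>
     vac \<noteq> 0"

fun gen_op ::
  "(nat \<Rightarrow> nat \<Rightarrow> 'v \<Rightarrow> 'v) \<Rightarrow> (nat \<Rightarrow> nat \<Rightarrow> 'v \<Rightarrow> 'v) \<Rightarrow> quon_gen \<Rightarrow> 'v \<Rightarrow> 'v" where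
  "gen_op ann cre (Ann i k) = ann i k"
| "gen_op ann cre (Cre i k) = cre i k"

text \<open>Elements of \<open>A\<close> whose coefficients have no pole at the real number \<open>q\<close>: only these
  can act on a representation in which the variable takes the value \<open>q\<close>.\<close>

definition regular_alg :: "real \<Rightarrow> nat \<Rightarrow> quon_poly set" where
  "regular_alg q m = {x \<in> free_alg m. \<forall>w. regular_at q (Poly_Mapping.lookup x w)}"

definition act ::
  "real \<Rightarrow> (nat \<Rightarrow> nat \<Rightarrow> 'v \<Rightarrow> 'v) \<Rightarrow> (nat \<Rightarrow> nat \<Rightarrow> 'v \<Rightarrow> 'v) \<Rightarrow> quon_poly \<Rightarrow> 'v::real_vector \<Rightarrow> 'v" where
  "act q ann cre x v =
     (\<Sum>w\<in>Poly_Mapping.keys x.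
        eval_at q (Poly_Mapping.lookup x w) *\<^sub>R foldr (gen_op ann cre) w v)"

definition fock_space ::
  "real \<Rightarrow> nat \<Rightarrow> (nat \<Rightarrow> nat \<Rightarrow> 'v \<Rightarrow> 'v) \<Rightarrow> (nat \<Rightarrow> nat \<Rightarrow> 'v \<Rightarrow> 'v) \<Rightarrow> 'v::real_vector \<Rightarrow> 'v set" where
  "fock_space q m ann cre vac = {act q ann cre x vac | x. x \<in> regular_alg q m}"


section \<open>Inner products on subspaces and Hilbert completion\<close>

definition inner_product_on :: "'v::real_vector set \<Rightarrow> ('v \<Rightarrow> 'v \<Rightarrow> real) \<Rightarrow> bool" where
  "inner_product_on S B \<longleftrightarrow>
     subspace S \<and>
     (\<forall>x\<in>S. \<forall>y\<in>S. \<forall>z\<in>S. B (x + y) z = B x z + B y z) \<and>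
     (\<forall>c. \<forall>x\<in>S. \<forall>y\<in>S. B (c *\<^sub>R x) y = c * B x y) \<and>
     (\<forall>x\<in>S. \<forall>y\<in>S. B x y = B y x) \<and>
     (\<forall>x\<in>S. x \<noteq> 0 \<longrightarrow> B x x > 0)"

text \<open>The Hilbert space of square-summable real sequences.\<close>

typedef ell2 = "{f :: nat \<Rightarrow> real. summable (\<lambda>n. (f n)\<^sup>2)}"
  morphisms ell2_nth Abs_ell2
  by (rule exI[of _ "\<lambda>_. 0"]) simp

setup_lifting type_definition_ell2

lemma ell2_eqI: "(\<And>n. ell2_nth x n = ell2_nth y n) \<Longrightarrow> x = y"
  by (simp add: ell2_nth_inject[symmetric] ext)

lemma ell2_summable: "summable (\<lambda>n. (ell2_nth x n)\<^sup>2)"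
  using ell2_nth[of x] by simp

lemma square_summable_mult:
  fixes f g :: "nat \<Rightarrow> real"
  assumes "summable (\<lambda>n. (f n)\<^sup>2)" "summable (\<lambda>n. (g n)\<^sup>2)"
  shows "summable (\<lambda>n. f n * g n)"
proof (rule summable_comparison_test'[of "\<lambda>n. (f n)\<^sup>2 + (g n)\<^sup>2" 0])
  show "summable (\<lambda>n. (f n)\<^sup>2 + (g n)\<^sup>2)" using assms by (rule summable_add)
next
  fix n :: nat
  have "0 \<le> (\<bar>f n\<bar> - \<bar>g n\<bar>)\<^sup>2" by simp
  then have "2 * (\<bar>f n\<bar> * \<bar>g n\<bar>) \<le> (f n)\<^sup>2 + (g n)\<^sup>2"
    by (simp add: power2_diff mult.assoc)
  moreover have "0 \<le> \<bar>f n\<bar> * \<bar>g n\<bar>" by simp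
  ultimately show "norm (f n * g n) \<le> (f n)\<^sup>2 + (g n)\<^sup>2"
    unfolding real_norm_def abs_mult by linarith
qed

lemma square_summable_add:
  fixes f g :: "nat \<Rightarrow> real"
  assumes "summable (\<lambda>n. (f n)\<^sup>2)" "summable (\<lambda>n. (g n)\<^sup>2)"
  shows "summable (\<lambda>n. (f n + g n)\<^sup>2)"
proof -
  have "summable (\<lambda>n. ((f n)\<^sup>2 + (g n)\<^sup>2) + 2 * (f n * g n))"
    by (intro summable_add summable_mult square_summable_mult assms)
  then show ?thesis by (simp add: power2_sum algebra_simps)
qed

lemma square_summable_cmult:
  fixes f :: "nat \<Rightarrow> real"
  assumes "summable (\<lambda>n. (f n)\<^sup>2)"
  shows "summable (\<lambda>n. (c * f n)\<^sup>2)"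
  using summable_mult[OF assms, of "c\<^sup>2"] by (simp add: power_mult_distrib)

instantiation ell2 :: real_inner
begin

lift_definition zero_ell2 :: ell2 is "\<lambda>_. 0" by simp
lift_definition plus_ell2 :: "ell2 \<Rightarrow> ell2 \<Rightarrow> ell2" is "\<lambda>f g n. f n + g n"
  by (rule square_summable_add)
lift_definition uminus_ell2 :: "ell2 \<Rightarrow> ell2" is "\<lambda>f n. - f n" by simp
lift_definition minus_ell2 :: "ell2 \<Rightarrow> ell2 \<Rightarrow> ell2" is "\<lambda>f g n. f n - g n"
  using square_summable_add[of _ "\<lambda>n. - _ n"] by simp
lift_definition scaleR_ell2 :: "real \<Rightarrow> ell2 \<Rightarrow> ell2" is "\<lambda>c f n. c * f n"
  by (rule square_summable_cmult)
definition inner_ell2 :: "ell2 \<Rightarrow> ell2 \<Rightarrow> real" where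
  "inner_ell2 x y = suminf (\<lambda>n. ell2_nth x n * ell2_nth y n)"
definition norm_ell2 :: "ell2 \<Rightarrow> real" where "norm_ell2 x = sqrt (inner x x)"
definition sgn_ell2 :: "ell2 \<Rightarrow> ell2" where "sgn_ell2 x = inverse (norm x) *\<^sub>R x"
definition dist_ell2 :: "ell2 \<Rightarrow> ell2 \<Rightarrow> real" where "dist_ell2 x y = norm (x - y)"
definition uniformity_ell2 :: "(ell2 \<times> ell2) filter" where
  "uniformity_ell2 = (INF e\<in>{0<..}. principal {(x, y). dist x y < e})"
definition open_ell2 :: "ell2 set \<Rightarrow> bool" where
  "open_ell2 U \<longleftrightarrow> (\<forall>x\<in>U. eventually (\<lambda>(x', y). x' = x \<longrightarrow> y \<in> U) uniformity)"

instance
proof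
  fix x y z :: ell2 and c d :: real
  note sm = square_summable_mult[OF ell2_summable ell2_summable]
  show "x + y + z = x + (y + z)" "x + y = y + x" "0 + x = x" "- x + x = 0" "x - y = x + - y"
    "c *\<^sub>R (x + y) = c *\<^sub>R x + c *\<^sub>R y" "(c + d) *\<^sub>R x = c *\<^sub>R x + d *\<^sub>R x"
    "c *\<^sub>R d *\<^sub>R x = (c * d) *\<^sub>R x" "1 *\<^sub>R x = x"
    by (transfer, simp add: algebra_simps fun_eq_iff)+
  show "sgn x = inverse (norm x) *\<^sub>R x" by (simp add: sgn_ell2_def)
  show "dist x y = norm (x - y)" by (rule dist_ell2_def)
  show "uniformity = (INF e\<in>{0<..}. principal {(x::ell2, y). dist x y < e})"
    by (rule uniformity_ell2_def)
  show "open U = (\<forall>x\<in>U. \<forall>\<^sub>F (x', y) in uniformity. x' = x \<longrightarrow> y \<in> U)" for U :: "ell2 set"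
    by (rule open_ell2_def)
  show "inner x y = inner y x" by (simp add: inner_ell2_def mult.commute)
  show "inner (x + y) z = inner x z + inner y z"
    using suminf_add[OF sm[of x z] sm[of y z]]
    by (simp add: inner_ell2_def plus_ell2.rep_eq distrib_right)
  show "inner (c *\<^sub>R x) y = c * inner x y"
    using suminf_mult[OF sm[of x y], of c]
    by (simp add: inner_ell2_def scaleR_ell2.rep_eq mult.assoc)
  show "0 \<le> inner x x"
    unfolding inner_ell2_def by (rule suminf_nonneg[OF sm]) simp
  show "inner x x = 0 \<longleftrightarrow> x = 0"
  proof
    assume "inner x x = 0"
    then have "\<forall>n. ell2_nth x n * ell2_nth x n = 0"
      using suminf_eq_zero_iff[OF sm[of x x]] by (simp add: inner_ell2_def)
    then show "x = 0" by (intro ell2_eqI) (simp add: zero_ell2.rep_eq)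
  qed (simp add: inner_ell2_def zero_ell2.rep_eq)
  show "norm x = sqrt (inner x x)" by (rule norm_ell2_def)
qed

end

lemma ell2_sum_le_norm: "(\<Sum>n<K. (ell2_nth x n)\<^sup>2) \<le> (norm x)\<^sup>2"
proof -
  have "(norm x)\<^sup>2 = suminf (\<lambda>n. (ell2_nth x n)\<^sup>2)"
    unfolding power2_norm_eq_inner by (simp add: inner_ell2_def power2_eq_square)
  then show ?thesis using sum_le_suminf[OF ell2_summable[of x], of "{..<K}"] by simp
qed

lemma ell2_nth_le_norm: "\<bar>ell2_nth x n\<bar> \<le> norm x"
proof -
  have "(ell2_nth x n)\<^sup>2 \<le> (\<Sum>k<Suc n. (ell2_nth x k)\<^sup>2)"
    by (simp add: sum_nonneg)
  then have "(ell2_nth x n)\<^sup>2 \<le> (norm x)\<^sup>2"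
    using ell2_sum_le_norm order_trans by blast
  then show ?thesis using abs_le_square_iff[of "ell2_nth x n" "norm x"] by simp
qed

instance ell2 :: complete_space
proof
  fix X :: "nat \<Rightarrow> ell2" assume X: "Cauchy X"
  have "Cauchy (\<lambda>j. ell2_nth (X j) n)" for n
  proof (rule metric_CauchyI)
    fix e :: real assume "e > 0"
    then obtain M where M: "\<forall>i\<ge>M. \<forall>j\<ge>M. dist (X i) (X j) < e"
      using metric_CauchyD[OF X] by blast
    have "dist (ell2_nth (X i) n) (ell2_nth (X j) n) < e" if "i \<ge> M" "j \<ge> M" for i j
    proof -
      have "\<bar>ell2_nth (X i) n - ell2_nth (X j) n\<bar> \<le> norm (X i - X j)"
        using ell2_nth_le_norm[of "X i - X j" n] by (simp add: minus_ell2.rep_eq)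
      moreover have "norm (X i - X j) < e" using M that by (simp add: dist_norm)
      ultimately show ?thesis by (simp add: dist_norm)
    qed
    then show "\<exists>M. \<forall>i\<ge>M. \<forall>j\<ge>M. dist (ell2_nth (X i) n) (ell2_nth (X j) n) < e" by blast
  qed
  then have lim: "\<forall>n. \<exists>l. (\<lambda>j. ell2_nth (X j) n) \<longlonglongrightarrow> l"
    by (simp add: Cauchy_convergent_iff convergent_def)
  obtain f where f: "\<And>n. (\<lambda>j. ell2_nth (X j) n) \<longlonglongrightarrow> f n"
    using choice[OF lim] by blast
  have main: "\<exists>M. \<forall>i\<ge>M. \<forall>K. (\<Sum>n<K. (ell2_nth (X i) n - f n)\<^sup>2) \<le> e\<^sup>2" if "e > 0" for e
  proof -
    obtain M where M: "\<forall>i\<ge>M. \<forall>j\<ge>M. dist (X i) (X j) < e"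
      using metric_CauchyD[OF X \<open>e > 0\<close>] by blast
    have "(\<Sum>n<K. (ell2_nth (X i) n - f n)\<^sup>2) \<le> e\<^sup>2" if i: "i \<ge> M" for i K
    proof (rule LIMSEQ_le_const2)
      show "(\<lambda>j. \<Sum>n<K. (ell2_nth (X i) n - ell2_nth (X j) n)\<^sup>2)
              \<longlonglongrightarrow> (\<Sum>n<K. (ell2_nth (X i) n - f n)\<^sup>2)"
        by (intro tendsto_intros f)
      have "(\<Sum>n<K. (ell2_nth (X i) n - ell2_nth (X j) n)\<^sup>2) \<le> e\<^sup>2" if "j \<ge> M" for j
      proof -
        have "(\<Sum>n<K. (ell2_nth (X i) n - ell2_nth (X j) n)\<^sup>2) \<le> (norm (X i - X j))\<^sup>2"
          using ell2_sum_le_norm[of "X i - X j" K] by (simp add: minus_ell2.rep_eq)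
        also have "\<dots> \<le> e\<^sup>2"
          using M i that \<open>e > 0\<close> by (intro power_mono) (auto simp: dist_norm intro: less_imp_le)
        finally show ?thesis .
      qed
      then show "\<exists>N. \<forall>j\<ge>N. (\<Sum>n<K. (ell2_nth (X i) n - ell2_nth (X j) n)\<^sup>2) \<le> e\<^sup>2" by blast
    qed
    then show ?thesis by blast
  qed
  have sumI: "summable (\<lambda>n. (g n)\<^sup>2)" if "\<And>K. (\<Sum>n<K. (g n)\<^sup>2) \<le> C" for g :: "nat \<Rightarrow> real" and C
    using that by (intro summableI_nonneg_bounded[where x = C]) auto
  obtain M where M: "\<forall>i\<ge>M. \<forall>K. (\<Sum>n<K. (ell2_nth (X i) n - f n)\<^sup>2) \<le> 1"
    using main[of 1] by auto
  have "summable (\<lambda>n. (ell2_nth (X M) n - f n)\<^sup>2)"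
    using M by (intro sumI) auto
  then have "summable (\<lambda>n. (ell2_nth (X M) n + (-1) * (ell2_nth (X M) n - f n))\<^sup>2)"
    by (intro square_summable_add square_summable_cmult ell2_summable)
  then have sf: "summable (\<lambda>n. (f n)\<^sup>2)" by simp
  define L where "L = Abs_ell2 f"
  have L: "ell2_nth L = f" using sf by (simp add: L_def Abs_ell2_inverse)
  have "X \<longlonglongrightarrow> L"
  proof (rule metric_LIMSEQ_I)
    fix r :: real assume r: "r > 0"
    then obtain M where M: "\<forall>i\<ge>M. \<forall>K. (\<Sum>n<K. (ell2_nth (X i) n - f n)\<^sup>2) \<le> (r/2)\<^sup>2"
      using main[of "r/2"] by auto
    have "dist (X i) L < r" if "i \<ge> M" for i
    proof -
      have "(norm (X i - L))\<^sup>2 = suminf (\<lambda>n. (ell2_nth (X i - L) n)\<^sup>2)"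
        unfolding power2_norm_eq_inner by (simp add: inner_ell2_def power2_eq_square)
      also have "\<dots> \<le> (r/2)\<^sup>2"
        using M that by (intro suminf_le_const ell2_summable) (simp add: minus_ell2.rep_eq L)
      finally have "(norm (X i - L))\<^sup>2 \<le> (r/2)\<^sup>2" .
      moreover have "0 \<le> r/2" using r by simp
      ultimately have "norm (X i - L) \<le> r/2" by (rule power2_le_imp_le)
      then show ?thesis using r by (simp add: dist_norm)
    qed
    then show "\<exists>M. \<forall>i\<ge>M. dist (X i) L < r" by blast
  qed
  then show "convergent X" unfolding convergent_def by blast
qed

text \<open>\<open>fock_space q m ann cre vac\<close> consists of finite linear combinations and has countably
  infinite dimension, so no inner product makes it complete; as usual, it is a Hilbert space in the
  sense that its completion is one. The map \<open>J\<close> below exhibits that completion: it is an isometric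
  linear embedding of \<open>S\<close> onto a dense subspace of a complete inner product space.\<close>

definition pre_hilbert_on :: "'v::real_vector set \<Rightarrow> ('v \<Rightarrow> 'v \<Rightarrow> real) \<Rightarrow> bool" where
  "pre_hilbert_on S B \<longleftrightarrow>
     inner_product_on S B \<and>
     (\<exists>J :: 'v \<Rightarrow> ell2.
        (\<forall>x\<in>S. \<forall>y\<in>S. J (x + y) = J x + J y) \<and>
        (\<forall>c. \<forall>x\<in>S. J (c *\<^sub>R x) = c *\<^sub>R J x) \<and>
        (\<forall>x\<in>S. \<forall>y\<in>S. inner (J x) (J y) = B x y) \<and>
        closure (J ` S) = UNIV)"

end

theory Submission
  imports Defs "HOL-Combinatorics.Multiset_Permutations"
begin

text \<open>
  Normal ordering moves annihilators to the right, so everything is determined by how words act on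
  the creation words; this yields the vacuum expectation and shows that the form on creation words
  is the \<open>q\<close>-deformed Gram matrix
  \[ \sum_{\sigma} q^{\mathrm{inv}(\sigma)} \prod_i G(u_i, w_{\sigma(i)}), \]
  where \<open>G\<close> is block diagonal with blocks \<open>(1 - q) I + q J\<close> of size \<open>m\<close>, positive definite exactly
  for \<open>1 / (1 - m) < q < 1\<close>.

  Positivity: averaging over \<open>n!\<close> simultaneous relabellings turns this matrix into a pull-back of
  \<open>q ^ card (X \<triangle> Y) * (\<Prod>i. G (x i) (y i))\<close>, where \<open>X\<close>, \<open>Y\<close> are the inversion sets of two
  permutations. The first factor is a restriction of a tensor power of the 2 by 2 matrix with
  diagonal entries 1 and off-diagonal entries \<open>q\<close>, one factor for each pair of positions, so it is
  strictly positive definite for \<open>-1 < q < 1\<close>. A permutation is determined by its inversion set,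
  hence the pull-back is along an injective map and stays strictly positive definite.
\<close>

section \<open>Strictly positive definite kernels\<close>

text \<open>The form is described through representatives \<open>a\<close>, \<open>b\<close>, and
  \<open>V\<close> carries no form of its own, so it is not clear that the vacuum expectation of
  \<open>dag a * b\<close> depends only on the vectors \<open>a|0>\<close> and \<open>b|0>\<close>.
  Strictness of the positivity settles this: a linear relation between states \<open>c|0>\<close>
  would put its top-degree coefficients into the kernel of a Gram matrix. Hence the states are
  linearly independent, a bilinear form can be prescribed on them, and they form the countable basis
  from which orthonormal coordinates in \<open>ell2\<close> are built.

  In the sum over \<sigma> the weight and the product both depend on \<sigma>, so neither is a
  kernel in \<open>u\<close> and \<open>w\<close>. A second permutation, applied to both words,
  separates them: the weight becomes a kernel in two permutations and the product a kernel in two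
  rearranged words.

  The bounds on \<open>q\<close> have two sources. The blocks \<open>(1 - q) I + q J\<close> have
  eigenvalues \<open>1 - q\<close> and \<open>1 + (m - 1) q\<close>, while the 2 by 2 factors
  require \<open>-1 < q < 1\<close>. Since \<open>1 / (1 - m)\<close> is at least -1 for
  \<open>m > 1\<close>, the 2 by 2 factors set the lower bound only for
  \<open>m = 1\<close>.\<close>

definition pos_def_on :: "'a set \<Rightarrow> ('a \<Rightarrow> 'a \<Rightarrow> real) \<Rightarrow> bool" where
  "pos_def_on S k \<longleftrightarrow> (\<forall>c. (\<exists>x\<in>S. c x \<noteq> 0) \<longrightarrow> (\<Sum>x\<in>S. \<Sum>y\<in>S. c x * c y * k x y) > 0)"

lemma pos_def_onD: "pos_def_on S k \<Longrightarrow> x \<in> S \<Longrightarrow> c x \<noteq> 0 \<Longrightarrow> (\<Sum>x\<in>S. \<Sum>y\<in>S. c x * c y * k x y) > 0"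
  unfolding pos_def_on_def by blast

lemma pos_def_on_nonneg: "pos_def_on S k \<Longrightarrow> (\<Sum>x\<in>S. \<Sum>y\<in>S. c x * c y * k x y) \<ge> 0"
  by (cases "\<exists>x\<in>S. c x \<noteq> 0") (auto simp: pos_def_on_def less_imp_le)

text \<open>A test vector on \<open>T\<close> is pushed forward along \<open>f\<close> and extended
  by 0. The quadratic form keeps its value, and injectivity keeps the vector nonzero.\<close>

lemma pos_def_on_pullback:
  assumes "pos_def_on S k" "finite S" and inj: "inj_on f T" and fT: "f ` T \<subseteq> S"
    and k': "\<And>x y. x \<in> T \<Longrightarrow> y \<in> T \<Longrightarrow> k' x y = k (f x) (f y)"
  shows "pos_def_on T k'"
  unfolding pos_def_on_def
proof (intro allI impI)
  fix c :: "'b \<Rightarrow> real" assume "\<exists>x\<in>T. c x \<noteq> 0"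
  then obtain x0 where x0: "x0 \<in> T" "c x0 \<noteq> 0" by blast
  define c' where "c' s = (if s \<in> f ` T then c (inv_into T f s) else 0)" for s
  have c': "c' (f x) = c x" if "x \<in> T" for x using inj that by (simp add: c'_def)
  have restrict: "(\<Sum>s\<in>S. c' s * g s) = (\<Sum>x\<in>T. c x * g (f x))" for g :: "'a \<Rightarrow> real"
  proof -
    have "(\<Sum>s\<in>S. c' s * g s) = (\<Sum>s\<in>f ` T. c' s * g s)"
      using fT assms(2) by (intro sum.mono_neutral_right) (auto simp: c'_def)
    then show ?thesis by (simp add: sum.reindex[OF inj] c')
  qed
  have "(\<Sum>s\<in>S. \<Sum>t\<in>S. c' s * c' t * k s t) = (\<Sum>s\<in>S. c' s * (\<Sum>t\<in>S. c' t * k s t))"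
    by (simp add: sum_distrib_left mult.assoc)
  also have "\<dots> = (\<Sum>x\<in>T. c x * (\<Sum>y\<in>T. c y * k (f x) (f y)))"
    by (simp only: restrict)
  also have "\<dots> = (\<Sum>x\<in>T. \<Sum>y\<in>T. c x * c y * k' x y)"
    by (simp add: sum_distrib_left mult.assoc k')
  finally show "(\<Sum>x\<in>T. \<Sum>y\<in>T. c x * c y * k' x y) > 0"
    using pos_def_onD[OF assms(1), of "f x0" c'] x0 fT c' by auto
qed

text \<open>Factoring \<open>g\<close> through \<open>L\<close> splits the form into one
  \<open>k\<close>-form for each \<open>j\<close>, evaluated at the contraction of \<open>c\<close>
  with row \<open>j\<close> of \<open>L\<close>. Each is nonnegative, and as \<open>L\<close> has
  trivial kernel, some contraction is nonzero.\<close>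

lemma pos_def_on_tensor:
  fixes L :: "'j \<Rightarrow> 'a \<Rightarrow> real"
  assumes k: "pos_def_on S k" and fin: "finite A" "finite J"
    and inj: "\<And>c a. (\<And>j. j \<in> J \<Longrightarrow> (\<Sum>a\<in>A. L j a * c a) = 0) \<Longrightarrow> a \<in> A \<Longrightarrow> c a = 0"
    and g: "\<And>a b. a \<in> A \<Longrightarrow> b \<in> A \<Longrightarrow> g a b = (\<Sum>j\<in>J. L j a * L j b)"
  shows "pos_def_on (A \<times> S) (\<lambda>x y. g (fst x) (fst y) * k (snd x) (snd y))"
  unfolding pos_def_on_def
proof (intro allI impI)
  fix c :: "'a \<times> 'b \<Rightarrow> real" assume "\<exists>x\<in>A \<times> S. c x \<noteq> 0"
  then obtain a0 x0 where ax: "a0 \<in> A" "x0 \<in> S" "c (a0, x0) \<noteq> 0" by blast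
  define D where "D j x = (\<Sum>a\<in>A. L j a * c (a, x))" for j x
  define Q where "Q j = (\<Sum>x\<in>S. \<Sum>y\<in>S. D j x * D j y * k x y)" for j
  have "(\<Sum>x\<in>A \<times> S. \<Sum>y\<in>A \<times> S. c x * c y * (g (fst x) (fst y) * k (snd x) (snd y)))
      = (\<Sum>a\<in>A. \<Sum>x\<in>S. \<Sum>b\<in>A. \<Sum>y\<in>S. \<Sum>j\<in>J. L j a * c (a, x) * (L j b * c (b, y)) * k x y)"
    by (simp add: sum.cartesian_product' g sum_distrib_left sum_distrib_right mult_ac)
  also have "\<dots> = (\<Sum>a\<in>A. \<Sum>x\<in>S. \<Sum>b\<in>A. \<Sum>j\<in>J. \<Sum>y\<in>S. L j a * c (a, x) * (L j b * c (b, y)) * k x y)"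
    by (intro sum.cong refl sum.swap)
  also have "\<dots> = (\<Sum>a\<in>A. \<Sum>x\<in>S. \<Sum>j\<in>J. \<Sum>b\<in>A. \<Sum>y\<in>S. L j a * c (a, x) * (L j b * c (b, y)) * k x y)"
    by (intro sum.cong refl sum.swap)
  also have "\<dots> = (\<Sum>a\<in>A. \<Sum>j\<in>J. \<Sum>x\<in>S. \<Sum>b\<in>A. \<Sum>y\<in>S. L j a * c (a, x) * (L j b * c (b, y)) * k x y)"
    by (intro sum.cong refl sum.swap)
  also have "\<dots> = (\<Sum>j\<in>J. \<Sum>a\<in>A. \<Sum>x\<in>S. \<Sum>b\<in>A. \<Sum>y\<in>S. L j a * c (a, x) * (L j b * c (b, y)) * k x y)"
    by (rule sum.swap)
  also have "\<dots> = (\<Sum>j\<in>J. \<Sum>x\<in>S. \<Sum>a\<in>A. \<Sum>b\<in>A. \<Sum>y\<in>S. L j a * c (a, x) * (L j b * c (b, y)) * k x y)"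
    by (intro sum.cong refl sum.swap)
  also have "\<dots> = (\<Sum>j\<in>J. \<Sum>x\<in>S. \<Sum>a\<in>A. \<Sum>y\<in>S. \<Sum>b\<in>A. L j a * c (a, x) * (L j b * c (b, y)) * k x y)"
    by (intro sum.cong refl sum.swap)
  also have "\<dots> = (\<Sum>j\<in>J. \<Sum>x\<in>S. \<Sum>y\<in>S. \<Sum>a\<in>A. \<Sum>b\<in>A. L j a * c (a, x) * (L j b * c (b, y)) * k x y)"
    by (intro sum.cong refl sum.swap)
  also have "\<dots> = (\<Sum>j\<in>J. Q j)"
    by (simp only: Q_def D_def sum_product, simp only: sum_distrib_right)
  finally have eq: "(\<Sum>x\<in>A \<times> S. \<Sum>y\<in>A \<times> S. c x * c y * (g (fst x) (fst y) * k (snd x) (snd y))) = (\<Sum>j\<in>J. Q j)" .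
  obtain j where j: "j \<in> J" "D j x0 \<noteq> 0"
    using inj[of "\<lambda>a. c (a, x0)" a0] ax by (auto simp: D_def)
  have "Q j > 0" using pos_def_onD[OF k ax(2), of "D j"] j by (simp add: Q_def)
  moreover have "Q j \<ge> 0" for j unfolding Q_def by (rule pos_def_on_nonneg[OF k])
  ultimately have "(\<Sum>j\<in>J. Q j) > 0" using fin(2) j(1) by (meson sum_pos2)
  then show "(\<Sum>x\<in>A \<times> S. \<Sum>y\<in>A \<times> S. c x * c y * (g (fst x) (fst y) * k (snd x) (snd y))) > 0"
    by (simp add: eq)
qed

lemma pos_def_on_Pow:
  fixes q :: real and k :: "'b \<Rightarrow> 'b \<Rightarrow> real" and P :: "'a set"
  assumes q: "-1 < q" "q < 1" and k: "pos_def_on S k" and fin: "finite S" and "finite P"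
  shows "pos_def_on (Pow P \<times> S)
    (\<lambda>x y. q ^ card (sym_diff (fst x) (fst y)) * k (snd x) (snd y))"
  using \<open>finite P\<close>
proof (induction P)
  case empty
  show ?case
    by (rule pos_def_on_pullback[OF k fin, of snd]) (auto simp: inj_on_def)
next
  case (insert p P)
  \<comment> \<open>Cholesky factor of the matrix with diagonal 1 and off-diagonal \<open>q\<close>;
    it is invertible because \<open>q^2 < 1\<close>.\<close>
  define L where "L j (a::bool) = (if j then (if a then q else 1) else (if a then sqrt (1 - q^2) else 0))" for j a
  define k2 :: "'a set \<times> 'b \<Rightarrow> 'a set \<times> 'b \<Rightarrow> real"
    where "k2 = (\<lambda>x y. q ^ card (sym_diff (fst x) (fst y)) * k (snd x) (snd y))"
  have q2: "1 - q\<^sup>2 > 0" using q by (simp add: power2_eq_square abs_square_less_1 [unfolded power2_eq_square])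
  have "pos_def_on ((UNIV :: bool set) \<times> (Pow P \<times> S))
     (\<lambda>x y. (if fst x = fst y then 1 else q) * k2 (snd x) (snd y))"
  proof (rule pos_def_on_tensor[where J = UNIV and L = L])
    show "pos_def_on (Pow P \<times> S) k2" using insert.IH by (simp add: k2_def)
  next
    fix c :: "bool \<Rightarrow> real" and a assume "\<And>j. j \<in> UNIV \<Longrightarrow> (\<Sum>a\<in>UNIV. L j a * c a) = 0"
    from this[of True] this[of False] show "c a = 0"
      using q2 by (cases a) (auto simp: L_def UNIV_bool)
  next
    fix a b :: bool show "(if a = b then 1 else q) = (\<Sum>j\<in>UNIV. L j a * L j b)"
      using q2 by (simp add: L_def UNIV_bool power2_eq_square)
  qed auto
  then show ?case
  \<comment> \<open>A subset of \<open>insert p P\<close> is split into its membership bit at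
    \<open>p\<close> and the rest; two different bits account for one factor
    \<open>q\<close>.\<close>
  proof (rule pos_def_on_pullback[where f = "\<lambda>x. (p \<in> fst x, (fst x - {p}, snd x))"])
    show "finite ((UNIV :: bool set) \<times> (Pow P \<times> S))" using insert fin by auto
    show "inj_on (\<lambda>x. (p \<in> fst x, fst x - {p}, snd x)) (Pow (insert p P) \<times> S)"
      by (auto simp: inj_on_def)
    show "(\<lambda>x. (p \<in> fst x, fst x - {p}, snd x)) ` (Pow (insert p P) \<times> S) \<subseteq> UNIV \<times> Pow P \<times> S"
      by auto
    fix x y assume xy: "x \<in> Pow (insert p P) \<times> S" "y \<in> Pow (insert p P) \<times> S"
    define D where "D = sym_diff (fst x - {p}) (fst y - {p})"
    have "D \<subseteq> P" using xy by (auto simp: D_def)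
    then have fD: "finite D" using insert.hyps by (simp add: finite_subset)
    have "sym_diff (fst x) (fst y) = (if (p \<in> fst x) = (p \<in> fst y) then D else insert p D)"
      unfolding D_def by auto
    moreover have "p \<notin> D" by (simp add: D_def)
    ultimately show "q ^ card (sym_diff (fst x) (fst y)) * k (snd x) (snd y) =
       (if fst (p \<in> fst x, fst x - {p}, snd x) = fst (p \<in> fst y, fst y - {p}, snd y) then 1 else q) *
       k2 (snd (p \<in> fst x, fst x - {p}, snd x)) (snd (p \<in> fst y, fst y - {p}, snd y))"
      using fD by (auto simp: k2_def D_def[symmetric])
  qed
qed

section \<open>Gram matrix of single letters and its tensor powers\<close>

text \<open>The vacuum expectation of the annihilator indexed by \<open>a\<close> times the creator
  indexed by \<open>b\<close>, which is why \<open>snd b\<close> is the first index of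
  \<open>qbeta\<close>.\<close>

definition letter_form :: "real \<Rightarrow> nat \<Rightarrow> nat \<times> nat \<Rightarrow> nat \<times> nat \<Rightarrow> real" where
  "letter_form q m a b = (if fst a = fst b then q ^ qbeta m (snd b) (snd a) else 0)"

lemma qbeta_eq: "k \<in> {1..m} \<Longrightarrow> l \<in> {1..m} \<Longrightarrow> qbeta m k l = (if k = l then 0 else 1)"
proof -
  assume kl: "k \<in> {1..m}" "l \<in> {1..m}"
  have "[int l - int k = int m] (mod int m) \<longleftrightarrow> [int l - int k = 0] (mod int m)"
    by (simp add: cong_def)
  also have "\<dots> \<longleftrightarrow> [int l = int k] (mod int m)" by (simp add: cong_diff_iff_cong_0)
  \<comment> \<open>The indices are shifted from 1..m to 0..m-1, where congruent numbers are
    equal.\<close>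
  also have "\<dots> \<longleftrightarrow> [int (l - 1) = int (k - 1)] (mod int m)"
    using kl cong_add_rcancel[of "int (l-1)" 1 "int (k-1)" "int m"] by (simp add: of_nat_diff)
  also have "\<dots> \<longleftrightarrow> k = l"
    using kl cong_less_imp_eq_int[of "int (l - 1)" "int m" "int (k - 1)"] by (auto simp: cong_def)
  finally show ?thesis by (simp add: qbeta_def)
qed

lemma letter_form_tensor:
  fixes q :: real and k :: "'b \<Rightarrow> 'b \<Rightarrow> real"
  assumes m: "m \<ge> 1" and q: "q < 1" "1 + (real m - 1) * q > 0"
    and k: "pos_def_on S k" and I: "finite I"
  defines "A \<equiv> I \<times> {1..m}"
  shows "pos_def_on (A \<times> S)
    (\<lambda>x y. letter_form q m (fst x) (fst y) * k (snd x) (snd y))"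
proof -
  \<comment> \<open>The \<open>m\<close> vectors with \<open>j\<close>-th entry \<open>s * \<delta>\<^sub>j\<^sub>k + \<alpha>\<close> have Gram matrix \<open>(1 - q) I + q J\<close>.\<close>
  define s where "s = sqrt (1 - q)"
  define r where "r = sqrt (1 + (real m - 1) * q)"
  \<comment> \<open>The matrix with diagonal \<open>s + \<alpha>\<close> and off-diagonal
    \<open>\<alpha>\<close> has eigenvalue \<open>s\<close> on vectors of sum 0 and
    \<open>s + m * \<alpha>\<close> on constant ones. The choice of \<open>\<alpha>\<close> makes
    the latter \<open>r\<close>, so that it is the square root of the block.\<close>
  define \<alpha> where "\<alpha> = (r - s) / m"
  define L where "L j a = (if fst j = fst a then (if snd j = snd a then s else 0) + \<alpha> else 0)"
    for j a :: "nat \<times> nat"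
  have s: "s > 0" "s * s = 1 - q" using q by (auto simp: s_def)
  have r: "r > 0" "r * r = 1 + (real m - 1) * q" using q by (auto simp: r_def)
  have \<alpha>: "m * \<alpha> + s = r" using m by (simp add: \<alpha>_def)
  have rr: "2 * (s * \<alpha>) + m * (\<alpha> * \<alpha>) = q"
  proof -
    have "r * r = m * (m * (\<alpha> * \<alpha>)) + m * (2 * (s * \<alpha>)) + s * s"
      unfolding \<alpha>[symmetric] by (simp add: algebra_simps)
    then have "m * (2 * (s * \<alpha>) + m * (\<alpha> * \<alpha>)) = m * q"
      unfolding r s by (simp add: algebra_simps)
    then show ?thesis using m by simp
  qed
  show ?thesis
  proof (rule pos_def_on_tensor[OF k, where J = A and L = L])
    show "finite A" "finite A" using I by (auto simp: A_def)
  next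
    fix c :: "nat \<times> nat \<Rightarrow> real" and a
    assume c: "\<And>j. j \<in> A \<Longrightarrow> (\<Sum>a\<in>A. L j a * c a) = 0" and a: "a \<in> A"
    obtain i l where il: "a = (i, l)" "i \<in> I" "l \<in> {1..m}" using a by (auto simp: A_def)
    define C where "C = (\<Sum>k\<in>{1..m}. c (i, k))"
    have row: "s * c (i, k) + \<alpha> * C = 0" if "k \<in> {1..m}" for k
    proof -
      have "0 = (\<Sum>i'\<in>I. \<Sum>k'\<in>{1..m}. L (i, k) (i', k') * c (i', k'))"
        using c[of "(i, k)"] that il by (simp add: A_def sum.cartesian_product')
      also have "\<dots> = (\<Sum>i'\<in>I. if i = i' then (\<Sum>k'\<in>{1..m}. L (i, k) (i, k') * c (i, k')) else 0)"
        by (rule sum.cong) (auto simp: L_def)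
      also have "\<dots> = (\<Sum>k'\<in>{1..m}. L (i, k) (i, k') * c (i, k'))" using I il by simp
      also have "\<dots> = (\<Sum>k'\<in>{1..m}. (if k = k' then s * c (i, k') else 0) + \<alpha> * c (i, k'))"
        by (rule sum.cong) (auto simp: L_def algebra_simps)
      also have "\<dots> = s * c (i, k) + \<alpha> * C"
        using that by (simp add: sum.distrib C_def sum_distrib_left)
      finally show ?thesis by simp
    qed
    \<comment> \<open>Adding the rows of a block pairs it with the constant vector, of eigenvalue
      \<open>r\<close>. So the block sum \<open>C\<close> vanishes, and then every single
      entry.\<close>
    have "0 = (\<Sum>k\<in>{1..m}. s * c (i, k) + \<alpha> * C)" using row by simp
    also have "\<dots> = r * C"
      unfolding \<alpha>[symmetric] by (simp add: sum.distrib sum_distrib_left[symmetric] C_def algebra_simps)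
    finally have "C = 0" using r by simp
    then show "c a = 0" using row[of l] il s by simp
  next
    fix a b assume ab: "a \<in> A" "b \<in> A"
    obtain i l where il: "a = (i, l)" "i \<in> I" "l \<in> {1..m}" using ab by (auto simp: A_def)
    obtain j k where jk: "b = (j, k)" "j \<in> I" "k \<in> {1..m}" using ab by (auto simp: A_def)
    have "(\<Sum>h\<in>A. L h a * L h b) = (\<Sum>i'\<in>I. \<Sum>k'\<in>{1..m}. L (i', k') a * L (i', k') b)"
      by (simp add: A_def sum.cartesian_product')
    also have "\<dots> = (\<Sum>i'\<in>I. if i = i' then (\<Sum>k'\<in>{1..m}. L (i, k') a * L (i, k') b) else 0)"
      by (rule sum.cong) (auto simp: L_def il)
    also have "\<dots> = (\<Sum>k'\<in>{1..m}. L (i, k') a * L (i, k') b)" using I il by simp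
    also have "\<dots> = letter_form q m a b"
    proof (cases "i = j")
      case True
      have "(\<Sum>k'\<in>{1..m}. L (i, k') a * L (i, k') b) =
        (\<Sum>k'\<in>{1..m}. (if k' = l then (if l = k then s * s else 0) + s * \<alpha> else 0) + (if k' = k then s * \<alpha> else 0) + \<alpha> * \<alpha>)"
        by (rule sum.cong) (auto simp: L_def il jk True algebra_simps)
      also have "\<dots> = (if l = k then s * s else 0) + 2 * (s * \<alpha>) + m * (\<alpha> * \<alpha>)"
        using il jk by (simp add: sum.distrib)
      also have "\<dots> = (if l = k then 1 else q)" using rr s by simp
      finally show ?thesis using il jk True by (auto simp: letter_form_def qbeta_eq)
    next
      case False
      then show ?thesis by (simp add: letter_form_def il jk L_def)
    qed
    finally show "letter_form q m a b = (\<Sum>h\<in>A. L h a * L h b)" by simp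
  qed
qed

text \<open>The product stops at the end of the shorter word; only words of equal length matter
  below.\<close>

fun word_form :: "real \<Rightarrow> nat \<Rightarrow> (nat \<times> nat) list \<Rightarrow> (nat \<times> nat) list \<Rightarrow> real" where
  "word_form q m (a # u) (b # w) = letter_form q m a b * word_form q m u w"
| "word_form q m _ _ = 1"

text \<open>In length \<open>n\<close> this is the \<open>n\<close>-th tensor power of
  \<open>letter_form\<close>; \<open>hd\<close> and \<open>tl\<close> split off one tensor
  factor.\<close>

lemma pos_def_on_word_form:
  assumes "m \<ge> 1" "q < 1" "1 + (real m - 1) * q > 0" "finite I"
  shows "pos_def_on {u. set u \<subseteq> I \<times> {1..m} \<and> length u = n} (word_form q m)"
proof (induction n)
  case 0
  have "{u. set u \<subseteq> I \<times> {1..m} \<and> length u = 0} = {[]}" by auto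
  then show ?case by (simp add: pos_def_on_def zero_less_mult_iff linorder_neq_iff)
next
  case (Suc n)
  show ?case
  proof (rule pos_def_on_pullback[OF letter_form_tensor[OF assms(1-3) Suc assms(4)],
        where f = "\<lambda>u. (hd u, tl u)"])
    show "finite ((I \<times> {1..m}) \<times> {u. set u \<subseteq> I \<times> {1..m} \<and> length u = n})"
      using assms(4) by (intro finite_cartesian_product finite_lists_length_eq) auto
    show "inj_on (\<lambda>u. (hd u, tl u)) {u. set u \<subseteq> I \<times> {1..m} \<and> length u = Suc n}"
      by (rule inj_onI, rule list.expand) auto
    show "(\<lambda>u. (hd u, tl u)) ` {u. set u \<subseteq> I \<times> {1..m} \<and> length u = Suc n}
      \<subseteq> (I \<times> {1..m}) \<times> {u. set u \<subseteq> I \<times> {1..m} \<and> length u = n}"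
      by (auto simp: length_Suc_conv)
  qed (auto simp: length_Suc_conv)
qed

lemma word_form_prod:
  "length u = length w \<Longrightarrow> word_form q m u w = (\<Prod>i<length u. letter_form q m (u ! i) (w ! i))"
  by (induction u w rule: list_induct2) (simp_all add: prod.lessThan_Suc_shift del: prod.lessThan_Suc)

section \<open>Normal ordering\<close>

text \<open>Words act on functions of creation words, dually to their action on the Fock space:
  \<open>dual_word s m w f c\<close> is the value of \<open>f\<close>, extended linearly, at the normal form of \<open>w c|0\<rangle>\<close>.
  Only the action \<open>s\<close> of \<open>q\<close> on the values is needed, so that the same recursion serves for values
  in \<open>real poly\<close>, R(q), \<open>real\<close> and the representation space.\<close>

fun contract :: "('b \<Rightarrow> 'b::comm_monoid_add) \<Rightarrow> nat \<Rightarrow> nat \<times> nat \<Rightarrow> ((nat \<times> nat) list \<Rightarrow> 'b) \<Rightarrow> (nat \<times> nat) list \<Rightarrow> 'b" where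
  "contract s m a f [] = 0"
| "contract s m a f (b # c) =
     (if fst b = fst a then (s ^^ qbeta m (snd b) (snd a)) (f c) else 0) + s (contract s m a (\<lambda>d. f (b # d)) c)"

text \<open>The transpose of left multiplication by a generator. In \<open>contract\<close> the
  annihilator moves right through the creation word: at each letter it either contracts, or passes
  at the cost of one \<open>s\<close>. At the end it kills the vacuum, whence the value 0 at
  \<open>[]\<close>.\<close>

fun dual_gen :: "('b \<Rightarrow> 'b::comm_monoid_add) \<Rightarrow> nat \<Rightarrow> quon_gen \<Rightarrow> ((nat \<times> nat) list \<Rightarrow> 'b) \<Rightarrow> (nat \<times> nat) list \<Rightarrow> 'b" where
  "dual_gen s m (Ann i k) f c = contract s m (i, k) f c"
| "dual_gen s m (Cre i k) f c = f ((i, k) # c)"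

lemma dual_gen_Cre: "dual_gen s m (Cre i k) f = (\<lambda>c. f ((i, k) # c))"
  by (simp add: fun_eq_iff)

text \<open>Transposes compose in reverse order: the leftmost letter, which acts last on vectors, is
  the first to act on functions. Hence \<open>fold\<close> here, against \<open>foldr\<close> for
  operators.\<close>

abbreviation dual_word :: "('b \<Rightarrow> 'b::comm_monoid_add) \<Rightarrow> nat \<Rightarrow> quon_gen list \<Rightarrow> ((nat \<times> nat) list \<Rightarrow> 'b) \<Rightarrow> (nat \<times> nat) list \<Rightarrow> 'b" where
  "dual_word s m \<equiv> fold (dual_gen s m)"

definition cre_word :: "(nat \<times> nat) list \<Rightarrow> quon_gen list" where
  "cre_word c = map (\<lambda>(i, k). Cre i k) c"

lemma cre_word_simps [simp]:
  "cre_word [] = []" "cre_word (b # c) = Cre (fst b) (snd b) # cre_word c"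
  by (simp_all add: cre_word_def split: prod.split)

lemma Ann_in_gens [simp]: "Ann i k \<in> quon_gens m \<longleftrightarrow> (i, k) \<in> gen_indices m"
  and Cre_in_gens [simp]: "Cre i k \<in> quon_gens m \<longleftrightarrow> (i, k) \<in> gen_indices m"
  by (auto simp: quon_gens_def)

lemma cre_word_in_lists [simp]: "cre_word c \<in> lists (quon_gens m) \<longleftrightarrow> c \<in> lists (gen_indices m)"
  by (induction c) auto

text \<open>\<open>contract\<close> consults the function only at \<open>c\<close> with one letter
  deleted.\<close>

lemma contract_cong:
  assumes "\<And>d. set d \<subseteq> set c \<Longrightarrow> Suc (length d) = length c \<Longrightarrow> f d = g d"
  shows "contract s m a f c = contract s m a g c"
  using assms
proof (induction c arbitrary: f g)
  case (Cons b c)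
  have "contract s m a (\<lambda>d. f (b # d)) c = contract s m a (\<lambda>d. g (b # d)) c"
    by (rule Cons.IH, rule Cons.prems) auto
  moreover have "f c = g c" by (rule Cons.prems) auto
  ultimately show ?case by simp
qed simp

lemma dual_word_cong:
  assumes "w \<in> lists (quon_gens m)" "c \<in> lists (gen_indices m)"
    and "\<And>d. d \<in> lists (gen_indices m) \<Longrightarrow> f d = g d"
  shows "dual_word s m w f c = dual_word s m w g c"
  using assms
proof (induction w arbitrary: f g rule: list.induct)
  case (Cons x w)
  have "dual_gen s m x f d = dual_gen s m x g d" if "d \<in> lists (gen_indices m)" for d
  proof (cases x)
    case (Ann i k)
    then show ?thesis using that Cons.prems(3) by (auto intro!: contract_cong)
  next
    case (Cre i k)
    then show ?thesis using that Cons.prems by auto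
  qed
  then show ?case using Cons.IH[of "dual_gen s m x f" "dual_gen s m x g"] Cons.prems by simp
qed simp

locale linear_twist =
  fixes s :: "'b \<Rightarrow> 'b::comm_monoid_add"
  assumes s_add: "s (x + y) = s x + s y" and s_zero [simp]: "s 0 = 0"
begin

lemma funpow_zero [simp]: "(s ^^ n) 0 = 0"
  by (induction n) simp_all

lemma contract_zero [simp]: "contract s m a (\<lambda>c. 0) = (\<lambda>c. 0)"
proof
  show "contract s m a (\<lambda>c. 0) c = 0" for c by (induction c) simp_all
qed

lemma dual_gen_zero [simp]: "dual_gen s m g (\<lambda>c. 0) = (\<lambda>c. 0)"
  by (cases g) (simp_all add: fun_eq_iff)

lemma dual_word_zero [simp]: "dual_word s m w (\<lambda>c. 0) = (\<lambda>c. 0)"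
  by (induction w) simp_all

text \<open>Uniqueness of normal ordering: the commutation relations and the vanishing behind a
  final annihilator determine \<open>f\<close> from its values on creation words. It is applied to
  vacuum expectations, to the dagger of a word, and to the vectors \<open>w|0>\<close>.\<close>

lemma dual_word_normal_order:
  fixes f :: "quon_gen list \<Rightarrow> 'b"
  assumes rel: "\<And>u v i k j l. \<lbrakk>u \<in> lists (quon_gens m); v \<in> lists (quon_gens m);
        (i, k) \<in> gen_indices m; (j, l) \<in> gen_indices m\<rbrakk> \<Longrightarrow>
        f (u @ Ann j l # Cre i k # v) =
          s (f (u @ Cre i k # Ann j l # v)) + (if i = j then (s ^^ qbeta m k l) (f (u @ v)) else 0)"
    and ann: "\<And>u j l. u \<in> lists (quon_gens m) \<Longrightarrow> (j, l) \<in> gen_indices m \<Longrightarrow> f (u @ [Ann j l]) = 0"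
    and w: "w \<in> lists (quon_gens m)"
  shows "f w = dual_word s m w (\<lambda>c. f (cre_word c)) []"
proof -
  \<comment> \<open>The prefix \<open>u\<close> is arbitrary because every creator that the
    annihilator passes is absorbed into it.\<close>
  have step: "f (u @ Ann (fst a) (snd a) # cre_word c) = contract s m a (\<lambda>d. f (u @ cre_word d)) c"
    if "u \<in> lists (quon_gens m)" "a \<in> gen_indices m" "c \<in> lists (gen_indices m)" for u a c
    using that
  proof (induction c arbitrary: u)
    case Nil
    then show ?case using ann[of u "fst a" "snd a"] by simp
  next
    case (Cons b c)
    then have "f (u @ Ann (fst a) (snd a) # cre_word (b # c)) =
      s (f ((u @ [Cre (fst b) (snd b)]) @ Ann (fst a) (snd a) # cre_word c))
       + (if fst b = fst a then (s ^^ qbeta m (snd b) (snd a)) (f (u @ cre_word c)) else 0)"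
      using rel[of u "cre_word c" "fst b" "snd b" "fst a" "snd a"] by simp
    also have "f ((u @ [Cre (fst b) (snd b)]) @ Ann (fst a) (snd a) # cre_word c) =
       contract s m a (\<lambda>d. f ((u @ [Cre (fst b) (snd b)]) @ cre_word d)) c"
      using Cons by (intro Cons.IH) auto
    finally show ?case by (simp add: add.commute)
  qed
  \<comment> \<open>The letters of \<open>w\<close> are removed from the right, where they touch a
    word that is already in normal form; this changes \<open>c\<close>, which is therefore kept
    general.\<close>
  have "f (w @ cre_word c) = dual_word s m w (\<lambda>d. f (cre_word d)) c" if "c \<in> lists (gen_indices m)" for c
    using w that
  proof (induction w arbitrary: c rule: rev_induct)
    case (snoc g w)
    show ?case
    proof (cases g)
      case (Ann i k)
      have "f ((w @ [g]) @ cre_word c) = contract s m (i, k) (\<lambda>d. f (w @ cre_word d)) c"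
        using step[of w "(i, k)" c] snoc.prems Ann by simp
      also have "\<dots> = contract s m (i, k) (dual_word s m w (\<lambda>d. f (cre_word d))) c"
        using snoc by (intro contract_cong) auto
      finally show ?thesis using Ann by simp
    next
      case (Cre i k)
      then show ?thesis using snoc.IH[of "(i, k) # c"] snoc.prems by simp
    qed
  qed simp
  from this[of "[]"] show ?thesis by simp
qed

end

lemma funpow_hom: "(\<And>x. h (s x) = s' (h x)) \<Longrightarrow> h ((s ^^ n) x) = (s' ^^ n) (h x)"
  by (induction n) simp_all

lemma contract_hom:
  assumes h: "h 0 = 0" "\<And>x y. h (x + y) = h x + h y" "\<And>x. h (s x) = s' (h x)"
  shows "h (contract s m a f c) = contract s' m a (\<lambda>d. h (f d)) c"
  by (induction c arbitrary: f) (simp_all add: h funpow_hom[of h s s', OF h(3)])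

text \<open>This moves the recursion between value domains: polynomials into fractions or real
  numbers, vectors into real numbers by a linear functional, and real numbers into multiples of the
  vacuum.\<close>

lemma dual_word_hom:
  assumes h: "h 0 = 0" "\<And>x y. h (x + y) = h x + h y" "\<And>x. h (s x) = s' (h x)"
  shows "h (dual_word s m w f c) = dual_word s' m w (\<lambda>d. h (f d)) c"
proof (induction w arbitrary: f)
  case (Cons g w)
  have "(\<lambda>d. h (dual_gen s m g f d)) = dual_gen s' m g (\<lambda>d. h (f d))"
    by (cases g) (simp_all add: fun_eq_iff contract_hom[of h s s', OF h])
  then show ?case using Cons[of "dual_gen s m g f"] by simp
qed simp

text \<open>\<open>vacuum_value t m w\<close> is $\langle 0|w|0\rangle$ at \<open>q = t\<close>.\<close>

definition vacuum_value :: "'r::comm_ring_1 \<Rightarrow> nat \<Rightarrow> quon_gen list \<Rightarrow> 'r" where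
  "vacuum_value t m w = dual_word ((*) t) m w (\<lambda>c. if c = [] then 1 else 0) []"

lemma linear_twist_times: "linear_twist ((*) (t::'r::comm_ring_1))"
  by standard (simp_all add: distrib_left)

lemma funpow_times: "((*) t ^^ n) x = t ^ n * (x::'r::comm_ring_1)"
  by (induction n) (simp_all add: mult_ac)

lemma contract_linear:
  fixes t :: "'r::comm_ring_1"
  shows "contract ((*) t) m a (\<lambda>c. x * f c + y * g c) c = x * contract ((*) t) m a f c + y * contract ((*) t) m a g c"
  by (induction c arbitrary: f g) (simp_all add: funpow_times algebra_simps)

lemma dual_word_linear:
  fixes t :: "'r::comm_ring_1"
  shows "dual_word ((*) t) m w (\<lambda>c. x * f c + y * g c) c = x * dual_word ((*) t) m w f c + y * dual_word ((*) t) m w g c"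
proof (induction w arbitrary: f g)
  case (Cons h w)
  have "dual_gen ((*) t) m h (\<lambda>c. x * f c + y * g c) = (\<lambda>c. x * dual_gen ((*) t) m h f c + y * dual_gen ((*) t) m h g c)"
    by (cases h) (simp_all add: fun_eq_iff contract_linear)
  then show ?case using Cons by simp
qed simp

lemma vacuum_value_Nil [simp]: "vacuum_value t m [] = 1"
  by (simp add: vacuum_value_def)

lemma vacuum_value_Ann [simp]: "vacuum_value t m (w @ [Ann i k]) = 0"
  by (simp add: vacuum_value_def)

lemma vacuum_value_Cre [simp]: "vacuum_value t m (Cre i k # w) = 0"
proof -
  have "dual_gen ((*) t) m (Cre i k) (\<lambda>c. if c = [] then 1 else 0) = (\<lambda>c. 0)"
    by (simp add: fun_eq_iff)
  then show ?thesis
    by (simp add: vacuum_value_def linear_twist.dual_word_zero[OF linear_twist_times])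
qed

text \<open>The recursion equation of \<open>contract\<close> at a nonempty word is the commutation
  relation itself, for whatever function the prefix \<open>u\<close> has produced; linearity carries
  it through \<open>v\<close>.\<close>

lemma vacuum_value_relation:
  "vacuum_value t m (u @ Ann j l # Cre i k # v) =
     t * vacuum_value t m (u @ Cre i k # Ann j l # v) +
     (if i = j then t ^ qbeta m k l * vacuum_value t m (u @ v) else 0)"
proof -
  define f where "f = dual_word ((*) t) m u (\<lambda>c. if c = [] then 1 else 0)"
  have "dual_gen ((*) t) m (Cre i k) (dual_gen ((*) t) m (Ann j l) f) =
    (\<lambda>c. t * dual_gen ((*) t) m (Ann j l) (dual_gen ((*) t) m (Cre i k) f) c + (if i = j then t ^ qbeta m k l else 0) * f c)"
    by (simp add: fun_eq_iff funpow_times add.commute dual_gen_Cre)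
  then show ?thesis
    by (simp add: vacuum_value_def f_def[symmetric] dual_word_linear del: dual_gen.simps)
qed

section \<open>The anti-involution on words and the symmetry of the vacuum expectation\<close>

definition dag_word :: "quon_gen list \<Rightarrow> quon_gen list" where
  "dag_word w = rev (map dag_gen w)"

lemma dag_word_simps [simp]: "dag_word [] = []" "dag_word (g # w) = dag_word w @ [dag_gen g]"
  "dag_word (u @ w) = dag_word w @ dag_word u"
  by (simp_all add: dag_word_def)

lemma dag_gen_dag_gen [simp]: "dag_gen (dag_gen g) = g"
  by (cases g) simp_all

lemma dag_word_dag_word [simp]: "dag_word (dag_word w) = w"
  by (induction w) simp_all

lemma dag_gen_in_gens [simp]: "dag_gen g \<in> quon_gens m \<longleftrightarrow> g \<in> quon_gens m"
  by (cases g) simp_all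

lemma dag_word_in_lists [simp]: "dag_word w \<in> lists (quon_gens m) \<longleftrightarrow> w \<in> lists (quon_gens m)"
  by (induction w) auto

text \<open>By this symmetry the dagger turns the relation for two generators into the relation with
  their roles exchanged.\<close>

lemma qbeta_sym: "qbeta m k l = qbeta m l k"
proof -
  have "[int l - int k = int m] (mod int m) \<longleftrightarrow> int m dvd int l - int k" for l k
    by (simp add: cong_def mod_eq_0_iff_dvd)
  then show ?thesis by (simp add: qbeta_def dvd_diff_commute)
qed

text \<open>As a function of \<open>u\<close> the left side obeys the commutation relations, and it
  vanishes if \<open>u\<close> ends in an annihilator, since the daggered word then starts with a
  creator.\<close>

lemma vacuum_value_dag_left:
  fixes t :: "'r::comm_ring_1"
  assumes "u \<in> lists (quon_gens m)"
  shows "vacuum_value t m (dag_word u @ w) = dual_word ((*) t) m u (\<lambda>c. vacuum_value t m (dag_word (cre_word c) @ w)) []"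
proof (rule linear_twist.dual_word_normal_order[OF linear_twist_times _ _ assms])
  fix x y :: "quon_gen list" and i k j l
  show "vacuum_value t m (dag_word (x @ Ann j l # Cre i k # y) @ w) =
     t * vacuum_value t m (dag_word (x @ Cre i k # Ann j l # y) @ w) +
     (if i = j then ((*) t ^^ qbeta m k l) (vacuum_value t m (dag_word (x @ y) @ w)) else 0)"
    using vacuum_value_relation[of t m "dag_word y" i k j l "dag_word x @ w"]
    by (auto simp: funpow_times qbeta_sym[of m l k])
next
  fix x :: "quon_gen list" and j l
  show "vacuum_value t m (dag_word (x @ [Ann j l]) @ w) = 0" by simp
qed

lemma vacuum_value_dag:
  assumes "w \<in> lists (quon_gens m)"
  shows "vacuum_value t m (dag_word w) = vacuum_value t m w"
proof -
  have "vacuum_value t m (dag_word (cre_word c)) = (if c = [] then 1 else 0)" for c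
    by (cases c) auto
  then show ?thesis
    using vacuum_value_dag_left[OF assms, of t "[]"] by (simp add: vacuum_value_def)
qed

lemma vacuum_value_sym:
  assumes "u \<in> lists (quon_gens m)" "w \<in> lists (quon_gens m)"
  shows "vacuum_value t m (dag_word u @ w) = vacuum_value t m (dag_word w @ u)"
  using vacuum_value_dag[of "dag_word u @ w" m t] assms by simp

lemma vacuum_value_hom:
  assumes "h 0 = 0" "h 1 = 1" "\<And>x y. h (x + y) = h x + h y" "\<And>x. h (t * x) = t' * h x"
  shows "h (vacuum_value t m w) = vacuum_value t' m w"
  unfolding vacuum_value_def
  by (subst dual_word_hom[of h "(*) t" "(*) t'"]) (use assms in \<open>auto simp: if_distrib[of h] cong: if_cong\<close>)

section \<open>The form on creation words\<close>

lemma dual_word_cre_word: "dual_word s m (cre_word w) f c = f (w @ c)"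
  by (induction w arbitrary: f) (simp_all add: dual_gen_Cre)

definition gram :: "'r::comm_ring_1 \<Rightarrow> nat \<Rightarrow> (nat \<times> nat) list \<Rightarrow> (nat \<times> nat) list \<Rightarrow> 'r" where
  "gram t m u w = vacuum_value t m (dag_word (cre_word u) @ cre_word w)"

lemma gram_Nil: "gram t m [] w = (if w = [] then 1 else 0)"
  by (cases w) (simp_all add: gram_def)

lemma gram_eq_dual_word:
  "gram t m u = dual_word ((*) t) m (dag_word (cre_word u)) (\<lambda>c. if c = [] then 1 else 0)"
  by (simp add: fun_eq_iff gram_def vacuum_value_def dual_word_cre_word)

text \<open>The dagger places the annihilator of the first letter last, right next to
  \<open>w\<close>.\<close>

lemma gram_Cons: "gram t m (a # u) w = contract ((*) t) m a (gram t m u) w"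
  by (simp add: gram_eq_dual_word)

lemma gram_sym:
  assumes "u \<in> lists (gen_indices m)" "w \<in> lists (gen_indices m)"
  shows "gram t m u w = gram t m w u"
  unfolding gram_def using assms by (intro vacuum_value_sym) auto

lemma gram_length: "length u \<noteq> length w \<Longrightarrow> gram t m u w = 0"
proof (induction u arbitrary: w)
  case Nil
  then show ?case by (auto simp: gram_Nil)
next
  case (Cons a u)
  have "contract ((*) t) m a (gram t m u) w = contract ((*) t) m a (\<lambda>c. 0) w"
    using Cons by (intro contract_cong) auto
  then show ?case by (simp add: gram_Cons linear_twist.contract_zero[OF linear_twist_times])
qed

section \<open>The Gram matrix as a sum over permutations\<close>

definition inversions :: "nat list \<Rightarrow> (nat \<times> nat) set" where
  "inversions p = {(i, j). i < j \<and> j < length p \<and> p ! j < p ! i}"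

lemma inversions_subset: "inversions p \<subseteq> {..<length p} \<times> {..<length p}"
  by (auto simp: inversions_def)

lemma finite_inversions [simp]: "finite (inversions p)"
  by (rule finite_subset[OF inversions_subset]) simp

text \<open>Inversions at position 0 correspond to entries smaller than \<open>x\<close>; all others
  are inversions of \<open>p\<close> with both positions shifted by one.\<close>

lemma card_inversions_Cons:
  assumes "distinct p"
  shows "card (inversions (x # p)) = card {y \<in> set p. y < x} + card (inversions p)"
proof -
  define X where "X = (\<lambda>j. (0::nat, Suc j)) ` {j. j < length p \<and> p ! j < x}"
  define Y where "Y = map_prod Suc Suc ` inversions p"
  have "inversions (x # p) = X \<union> Y"
  proof (intro equalityI subsetI)
    fix z assume "z \<in> inversions (x # p)"
    then obtain i j where z: "z = (i, j)" "i < j" "j < Suc (length p)" "(x # p) ! j < (x # p) ! i"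
      by (auto simp: inversions_def)
    obtain j' where "j = Suc j'" using z by (cases j) auto
    show "z \<in> X \<union> Y"
    proof (cases i)
      case 0
      then show ?thesis using z \<open>j = Suc j'\<close> by (auto simp: X_def)
    next
      case (Suc i')
      then have "(i', j') \<in> inversions p" using z \<open>j = Suc j'\<close> by (auto simp: inversions_def)
      then show ?thesis using z \<open>j = Suc j'\<close> Suc by (force simp: Y_def)
    qed
  qed (auto simp: X_def Y_def inversions_def)
  moreover have "X \<inter> Y = {}" by (auto simp: X_def Y_def)
  moreover have "finite X" "finite Y" by (auto simp: X_def Y_def)
  moreover have "card Y = card (inversions p)"
    unfolding Y_def by (intro card_image inj_onI) (auto simp: map_prod_def split: prod.splits)
  moreover have "card X = card {j. j < length p \<and> p ! j < x}"
    unfolding X_def by (intro card_image) (auto simp: inj_on_def)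
  moreover have "card {j. j < length p \<and> p ! j < x} = card {y \<in> set p. y < x}"
  proof -
    have "{y \<in> set p. y < x} = (!) p ` {j. j < length p \<and> p ! j < x}"
      by (auto simp: set_conv_nth)
    moreover have "inj_on ((!) p) {j. j < length p \<and> p ! j < x}"
      using assms by (auto simp: inj_on_def nth_eq_iff_index_eq)
    ultimately show ?thesis by (simp add: card_image)
  qed
  ultimately show ?thesis by (simp add: card_Un_disjoint)
qed

text \<open>Contracting with the letter labelled \<open>x\<close> means passing all letters with
  smaller labels, at a factor \<open>q\<close> each. Summing over labels instead of letters keeps
  repeated letters apart.\<close>

lemma contract_sorted:
  fixes q :: real
  assumes "sorted_wrt (<) xs"
  shows "contract ((*) q) m a f (map w xs) =
    (\<Sum>x\<in>set xs. q ^ card {y \<in> set xs. y < (x::nat)} * letter_form q m a (w x) * f (map w (remove1 x xs)))"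
  using assms
proof (induction xs arbitrary: f)
  case (Cons x xs)
  have x: "x \<notin> set xs" "\<And>y. y \<in> set xs \<Longrightarrow> x < y" using Cons.prems by auto
  have "{y. (y = x \<or> y \<in> set xs) \<and> y < x} = {}" using x by force
  then have first: "card {y \<in> set (x # xs). y < x} = 0" by simp
  have other: "card {z \<in> set (x # xs). z < y} = Suc (card {z \<in> set xs. z < y})" if "y \<in> set xs" for y
  proof -
    have "{z \<in> set (x # xs). z < y} = insert x {z \<in> set xs. z < y}" using x that by auto
    then show ?thesis using x by simp
  qed
  have "(\<Sum>y\<in>set xs. q ^ card {z \<in> set (x # xs). z < y} * letter_form q m a (w y) * f (map w (remove1 y (x # xs))))
      = (\<Sum>y\<in>set xs. q * (q ^ card {z \<in> set xs. z < y} * letter_form q m a (w y) * f (w x # map w (remove1 y xs))))"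
    using x(1) by (intro sum.cong refl) (auto simp: other simp del: set_simps)
  also have "\<dots> = q * contract ((*) q) m a (\<lambda>d. f (w x # d)) (map w xs)"
    using Cons by (simp add: sum_distrib_left)
  finally show ?case
    using x(1) first by (auto simp: letter_form_def funpow_times simp del: card_eq_0_iff card_0_eq)
qed simp

text \<open>Each contraction partner \<open>x\<close> of the first letter of \<open>u\<close> is the
  first entry of a permutation, and the power of \<open>q\<close> paid for it is what that entry
  adds to the inversion count. General label sets are needed because \<open>A - {x}\<close> is no
  longer an initial segment.\<close>

lemma gram_permutations:
  fixes q :: real
  assumes "finite A"
  shows "gram q m u (map w (sorted_list_of_set A)) = (if length u = card A then
    (\<Sum>p\<in>permutations_of_set A. q ^ card (inversions p) * word_form q m u (map w p)) else 0)"
proof (cases "length u = card A")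
  case True
  have "gram q m u (map w (sorted_list_of_set A)) =
    (\<Sum>p\<in>permutations_of_set A. q ^ card (inversions p) * word_form q m u (map w p))"
    using assms True
  proof (induction u arbitrary: A)
    case Nil
    then show ?case by (simp add: gram_Nil inversions_def)
  next
    case (Cons a u)
    have fin: "finite A" and "A \<noteq> {}" using Cons.prems by auto
    have inner: "q ^ card {y \<in> A. y < x} * letter_form q m a (w x) *
          gram q m u (map w (sorted_list_of_set (A - {x}))) =
        (\<Sum>p\<in>(#) x ` permutations_of_set (A - {x}). q ^ card (inversions p) * word_form q m (a # u) (map w p))"
      if x: "x \<in> A" for x
    proof -
      have "card (inversions (x # p)) = card {y \<in> A. y < x} + card (inversions p)"
        if p: "p \<in> permutations_of_set (A - {x})" for p
      proof -
        have "{y \<in> set p. y < x} = {y \<in> A. y < x}" using permutations_of_setD[OF p] by auto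
        then show ?thesis using card_inversions_Cons[of p x] permutations_of_setD[OF p] by simp
      qed
      then show ?thesis
        using Cons.IH[of "A - {x}"] Cons.prems x
        by (simp add: sum.reindex power_add sum_distrib_left mult_ac card_Diff_singleton)
    qed
    have "gram q m (a # u) (map w (sorted_list_of_set A)) =
      (\<Sum>x\<in>A. q ^ card {y \<in> A. y < x} * letter_form q m a (w x) *
          gram q m u (map w (sorted_list_of_set (A - {x}))))"
      using contract_sorted[of "sorted_list_of_set A" q m a "gram q m u" w] fin
      by (simp add: gram_Cons sorted_list_of_set_remove)
    also have "\<dots> = (\<Sum>x\<in>A. \<Sum>p\<in>(#) x ` permutations_of_set (A - {x}).
        q ^ card (inversions p) * word_form q m (a # u) (map w p))"
      by (intro sum.cong refl inner)
    also have "\<dots> = (\<Sum>p\<in>(\<Union>x\<in>A. (#) x ` permutations_of_set (A - {x})).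
        q ^ card (inversions p) * word_form q m (a # u) (map w p))"
      using fin by (intro sum.UNION_disjoint[symmetric]) auto
    finally show ?case using permutations_of_set_nonempty[OF \<open>A \<noteq> {}\<close>] by simp
  qed
  then show ?thesis using True by simp
next
  case False
  then show ?thesis using assms by (simp add: gram_length)
qed

lemma bij_betw_nth_permutation: "s \<in> permutations_of_set {..<n} \<Longrightarrow> bij_betw ((!) s) {..<n} {..<n}"
  using permutations_of_setD[of s "{..<n}"] bij_betw_nth[of s "{..<n}" "{..<n}"]
  by (metis card_lessThan distinct_card)

lemma length_permutation: "s \<in> permutations_of_set {..<n} \<Longrightarrow> length s = n"
  by (simp add: length_finite_permutations_of_set)

lemma nth_permutation_less: "s \<in> permutations_of_set {..<n} \<Longrightarrow> i < n \<Longrightarrow> s ! i < n"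
  using bij_betw_nth_permutation[of s n] by (auto simp: bij_betw_def)

lemma bij_betw_compose_permutation:
  assumes s: "s \<in> permutations_of_set {..<n}"
  shows "bij_betw (\<lambda>p. map ((!) p) s) (permutations_of_set {..<n}) (permutations_of_set {..<n})"
proof -
  let ?P = "permutations_of_set {..<n}"
  have ran: "map ((!) p) s \<in> ?P" if "p \<in> ?P" for p
    using bij_betw_nth_permutation[OF that] permutations_of_setD[OF s]
    by (intro permutations_of_setI) (auto simp: bij_betw_def distinct_map)
  have inj: "inj_on (\<lambda>p. map ((!) p) s) ?P"
  proof (rule inj_onI)
    fix p p' assume p: "p \<in> ?P" "p' \<in> ?P" "map ((!) p) s = map ((!) p') s"
    then have "\<forall>i\<in>set s. p ! i = p' ! i" by simp
    then have "\<forall>i<n. p ! i = p' ! i" using permutations_of_setD[OF s] by auto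
    then show "p = p'" using p by (intro nth_equalityI) (auto simp: length_permutation)
  qed
  have "(\<lambda>p. map ((!) p) s) ` ?P = ?P"
    using ran inj by (intro card_subset_eq) (auto simp: card_image)
  then show ?thesis using inj by (simp add: bij_betw_def)
qed

text \<open>Both sides count the pairs of positions that \<open>s\<close> and \<open>p \<circ> s\<close> order differently.\<close>

lemma card_sym_diff_inversions:
  assumes s: "s \<in> permutations_of_set {..<n}" and p: "p \<in> permutations_of_set {..<n}"
  shows "card (sym_diff (inversions s) (inversions (map ((!) p) s))) = card (inversions p)"
proof (rule bij_betw_same_card)
  \<comment> \<open>A pair of positions of \<open>s\<close> goes to the increasing pair of its
    values, which are positions of \<open>p\<close>.\<close>
  let ?f = "\<lambda>(i, j). (min (s ! i) (s ! j), max (s ! i) (s ! j))"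
  have inj_s: "s ! i = s ! j \<longleftrightarrow> i = j" if "i < n" "j < n" for i j
    using that bij_betw_nth_permutation[OF s] by (auto simp: bij_betw_def inj_on_def)
  have inj_p: "p ! i = p ! j \<longleftrightarrow> i = j" if "i < n" "j < n" for i j
    using that bij_betw_nth_permutation[OF p] by (auto simp: bij_betw_def inj_on_def)
  have len: "length s = n" "length p = n" using s p by (auto simp: length_permutation)
  have D: "(i, j) \<in> sym_diff (inversions s) (inversions (map ((!) p) s)) \<longleftrightarrow>
      i < j \<and> j < n \<and> (s ! j < s ! i) \<noteq> (p ! (s ! j) < p ! (s ! i))" for i j
    by (auto simp: inversions_def len)
  show "bij_betw ?f (sym_diff (inversions s) (inversions (map ((!) p) s))) (inversions p)"
  proof (rule bij_betw_imageI)
    show "inj_on ?f (sym_diff (inversions s) (inversions (map ((!) p) s)))"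
    proof (rule inj_onI)
      fix x y assume x: "x \<in> sym_diff (inversions s) (inversions (map ((!) p) s))"
        and y: "y \<in> sym_diff (inversions s) (inversions (map ((!) p) s))" and eq: "?f x = ?f y"
      obtain i j where ij: "x = (i, j)" "i < j" "j < n" using x D by (cases x) blast
      obtain k l where kl: "y = (k, l)" "k < l" "l < n" using y D by (cases y) blast
      have "s ! i = s ! k \<and> s ! j = s ! l \<or> s ! i = s ! l \<and> s ! j = s ! k"
        using eq ij kl by (auto simp: min_def max_def split: if_splits)
      then show "x = y" using ij kl inj_s by auto
    qed
    show "?f ` sym_diff (inversions s) (inversions (map ((!) p) s)) = inversions p"
    proof (intro equalityI subsetI)
      fix z assume "z \<in> ?f ` sym_diff (inversions s) (inversions (map ((!) p) s))"
      then obtain i j where ij: "i < j" "j < n" "(s ! j < s ! i) \<noteq> (p ! (s ! j) < p ! (s ! i))"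
        and z: "z = (min (s ! i) (s ! j), max (s ! i) (s ! j))"
        using D by auto
      have "s ! i \<noteq> s ! j" "p ! (s ! i) \<noteq> p ! (s ! j)" "s ! i < n" "s ! j < n"
        using ij inj_s inj_p nth_permutation_less[OF s] by auto
      then show "z \<in> inversions p"
        using ij z by (auto simp: inversions_def len min_def max_def)
    next
      fix z assume "z \<in> inversions p"
      then obtain a b where z: "z = (a, b)" "a < b" "b < n" "p ! b < p ! a"
        by (auto simp: inversions_def len)
      have "a \<in> (!) s ` {..<n}" "b \<in> (!) s ` {..<n}"
        using z bij_betw_nth_permutation[OF s] by (auto simp: bij_betw_def)
      then obtain i j where ij: "i < n" "j < n" "s ! i = a" "s ! j = b" by auto
      then have "i \<noteq> j" using z by auto
      then consider "i < j" | "j < i" by linarith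
      then show "z \<in> ?f ` sym_diff (inversions s) (inversions (map ((!) p) s))"
      proof cases
        case 1
        then show ?thesis using D[of i j] ij z by (intro image_eqI[of _ _ "(i, j)"]) auto
      next
        case 2
        then show ?thesis using D[of j i] ij z by (intro image_eqI[of _ _ "(j, i)"]) auto
      qed
    qed
  qed
qed

lemma word_form_permute:
  assumes s: "s \<in> permutations_of_set {..<n}" and u: "length u = n" and p: "length p = n"
  shows "word_form q m (map ((!) u) s) (map w (map ((!) p) s)) = word_form q m u (map w p)"
proof -
  have "word_form q m (map ((!) u) s) (map w (map ((!) p) s)) =
    (\<Prod>i<n. letter_form q m (u ! (s ! i)) (w (p ! (s ! i))))"
    using s by (simp add: word_form_prod length_permutation)
  also have "\<dots> = (\<Prod>j<n. letter_form q m (u ! j) (w (p ! j)))"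
    by (rule prod.reindex_bij_betw[OF bij_betw_nth_permutation[OF s]])
  finally show ?thesis using u p by (simp add: word_form_prod)
qed

text \<open>The substitution \<open>t = map ((!) p) s\<close> in the sum over \<open>p\<close>. The
  left side does not involve \<open>s\<close>, so summing over all \<open>s\<close> merely
  multiplies it by the number of permutations.\<close>

lemma gram_eq_sum_sym_diff:
  fixes q :: real
  assumes s: "s \<in> permutations_of_set {..<n}" and u: "length u = n" "length w = n"
  shows "gram q m u w = (\<Sum>t\<in>permutations_of_set {..<n}.
     q ^ card (sym_diff (inversions s) (inversions t)) * word_form q m (map ((!) u) s) (map ((!) w) t))"
proof -
  let ?P = "permutations_of_set {..<n}"
  have "w = map ((!) w) (sorted_list_of_set {..<n})"
    using u by (metis lessThan_atLeast0 map_nth sorted_list_of_set_range)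
  then have "gram q m u w = (\<Sum>p\<in>?P. q ^ card (inversions p) * word_form q m u (map ((!) w) p))"
    using gram_permutations[of "{..<n}" q m u "(!) w"] u by simp
  also have "\<dots> = (\<Sum>p\<in>?P. q ^ card (sym_diff (inversions s) (inversions (map ((!) p) s)))
      * word_form q m (map ((!) u) s) (map ((!) w) (map ((!) p) s)))"
    by (intro sum.cong refl)
      (simp only: card_sym_diff_inversions[OF s] word_form_permute[OF s u(1) length_permutation])
  also have "\<dots> = (\<Sum>t\<in>?P. q ^ card (sym_diff (inversions s) (inversions t)) * word_form q m (map ((!) u) s) (map ((!) w) t))"
    by (rule sum.reindex_bij_betw[OF bij_betw_compose_permutation[OF s]])
  finally show ?thesis .
qed

text \<open>The entries are 0..n-1, so each one equals the number of smaller entries, and the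
  inversion set tells which entries are smaller.\<close>

lemma inj_on_inversions: "inj_on inversions (permutations_of_set {..<n})"
proof (rule inj_onI)
  fix s t assume s: "s \<in> permutations_of_set {..<n}" and t: "t \<in> permutations_of_set {..<n}"
    and eq: "inversions s = inversions t"
  have rank: "r ! i = card {j. j < n \<and> (j < i \<and> (j, i) \<notin> inversions r \<or> i < j \<and> (i, j) \<in> inversions r)}"
    if r: "r \<in> permutations_of_set {..<n}" and i: "i < n" for r i
  proof -
    have inj: "inj_on ((!) r) {..<n}" and im: "(!) r ` {..<n} = {..<n}"
      using bij_betw_nth_permutation[OF r] by (auto simp: bij_betw_def)
    have "{j. j < n \<and> (j < i \<and> (j, i) \<notin> inversions r \<or> i < j \<and> (i, j) \<in> inversions r)} = {j. j < n \<and> r ! j < r ! i}"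
      (is "?L = ?R")
    proof (intro equalityI subsetI)
      fix j assume "j \<in> ?L"
      moreover from this have "r ! j \<noteq> r ! i" using inj i by (auto simp: inj_on_def)
      ultimately show "j \<in> ?R" using i by (auto simp: inversions_def length_permutation[OF r])
    next
      fix j assume "j \<in> ?R"
      moreover from this have "j \<noteq> i" by auto
      ultimately show "j \<in> ?L" using i by (auto simp: inversions_def length_permutation[OF r])
    qed
    moreover have "card ?R = card ((!) r ` ?R)"
      by (rule card_image[symmetric]) (rule inj_on_subset[OF inj], auto)
    moreover have "(!) r ` ?R = {..<r ! i}"
    proof (intro equalityI subsetI)
      fix x assume "x \<in> {..<r ! i}"
      moreover have "r ! i < n" using im i by auto
      ultimately have "x \<in> (!) r ` {..<n}" using im by auto
      then show "x \<in> (!) r ` ?R" using \<open>x \<in> {..<r ! i}\<close> by auto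
    qed auto
    ultimately show ?thesis by simp
  qed
  show "s = t"
    by (rule nth_equalityI) (auto simp: length_permutation[OF s] length_permutation[OF t] rank[OF s] rank[OF t] eq)
qed

lemma gram_pos_def_on_length:
  fixes q :: real
  assumes m: "m \<ge> 1" and q: "-1 < q" "q < 1" "1 + (real m - 1) * q > 0" and I: "finite I"
  shows "pos_def_on {u. set u \<subseteq> I \<times> {1..m} \<and> length u = n} (gram q m)"
proof -
  define W where "W = {u. set u \<subseteq> I \<times> {1..m} \<and> length u = n}"
  define P where "P = permutations_of_set {..<n}"
  define k where "k x y = q ^ card (sym_diff (fst x) (fst y)) * word_form q m (snd x) (snd y)"
    for x y :: "(nat \<times> nat) set \<times> (nat \<times> nat) list"
  define f where "f x = (inversions (snd x), map ((!) (fst x)) (snd x))"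
    for x :: "(nat \<times> nat) list \<times> nat list"
  have finW: "finite W" using I by (simp add: W_def finite_lists_length_eq)
  have finP: "finite P" by (simp add: P_def)
  have "pos_def_on (Pow ({..<n} \<times> {..<n}) \<times> W) k"
    unfolding k_def W_def
    by (rule pos_def_on_Pow[OF q(1,2) pos_def_on_word_form[OF m q(2,3) I]])
      (use I in \<open>auto simp: finite_lists_length_eq\<close>)
  then have pos: "pos_def_on (W \<times> P) (\<lambda>x y. k (f x) (f y))"
  proof (rule pos_def_on_pullback)
    show "finite (Pow ({..<n} \<times> {..<n}) \<times> W)" using finW by simp
    \<comment> \<open>The permutation is recovered from its inversion set; then \<open>u\<close> is
      recovered from its rearrangement, as the permutation reaches every position.\<close>
    show "inj_on f (W \<times> P)"
    proof (rule inj_onI)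
      fix x y assume x: "x \<in> W \<times> P" and y: "y \<in> W \<times> P" and eq: "f x = f y"
      have s: "snd x = snd y"
      proof (rule inj_onD[OF inj_on_inversions])
        show "inversions (snd x) = inversions (snd y)" using eq by (simp add: f_def)
        show "snd x \<in> permutations_of_set {..<n}" "snd y \<in> permutations_of_set {..<n}"
          using x y unfolding P_def by (simp_all only: mem_Times_iff)
      qed
      have "fst x ! i = fst y ! i" if "i < n" for i
      proof -
        have "snd y \<in> permutations_of_set {..<n}" using y unfolding P_def by (simp only: mem_Times_iff)
        then have "i \<in> set (snd y)" using that permutations_of_setD(1) by blast
        then show ?thesis using eq s by (simp add: f_def)
      qed
      then have "fst x = fst y" using x y by (intro nth_equalityI) (auto simp: W_def)
      then show "x = y" using s by (rule prod_eqI)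
    qed
    show "f ` (W \<times> P) \<subseteq> Pow ({..<n} \<times> {..<n}) \<times> W"
    proof
      fix z assume "z \<in> f ` (W \<times> P)"
      then obtain u s where z: "z = f (u, s)" and u: "u \<in> W" and s: "s \<in> P" by auto
      have len: "length s = n" and set: "set s = {..<n}"
        using s by (auto simp: P_def length_permutation dest: permutations_of_setD)
      have "inversions s \<subseteq> {..<n} \<times> {..<n}" using inversions_subset[of s] len by simp
      moreover have "(!) u ` {..<n} \<subseteq> set u" using u by (auto simp: W_def)
      then have "map ((!) u) s \<in> W"
        using u len set by (simp add: W_def order_trans[of _ "set u"])
      ultimately show "z \<in> Pow ({..<n} \<times> {..<n}) \<times> W" using z by (simp add: f_def)
    qed
  qed simp
  have "pos_def_on W (gram q m)"
    unfolding pos_def_on_def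
  proof (intro allI impI)
    fix c :: "(nat \<times> nat) list \<Rightarrow> real" assume "\<exists>u\<in>W. c u \<noteq> 0"
    then obtain u0 where u0: "u0 \<in> W" "c u0 \<noteq> 0" by blast
    have "P \<noteq> {}" by (simp add: P_def)
    then obtain s0 where s0: "s0 \<in> P" by blast
    \<comment> \<open>The test vector is constant in the permutation. For each fixed
      \<open>s\<close> the inner sum over \<open>t\<close> is then the Gram entry, and the sum over
      \<open>s\<close> gives the factor \<open>card P\<close>.\<close>
    have "(\<Sum>x\<in>W \<times> P. \<Sum>y\<in>W \<times> P. c (fst x) * c (fst y) * k (f x) (f y)) > 0"
      using pos_def_onD[OF pos, of "(u0, s0)" "\<lambda>x. c (fst x)"] u0 s0 by simp
    also have "(\<Sum>x\<in>W \<times> P. \<Sum>y\<in>W \<times> P. c (fst x) * c (fst y) * k (f x) (f y)) =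
      (\<Sum>u\<in>W. \<Sum>s\<in>P. \<Sum>w\<in>W. c u * c w * (\<Sum>t\<in>P. k (f (u, s)) (f (w, t))))"
      by (simp add: sum.cartesian_product' sum_distrib_left)
    also have "\<dots> = (\<Sum>u\<in>W. \<Sum>s\<in>P. \<Sum>w\<in>W. c u * c w * gram q m u w)"
      by (intro sum.cong refl arg_cong2[where f = "(*)"])
        (simp add: k_def f_def P_def W_def gram_eq_sum_sym_diff)
    also have "\<dots> = card P * (\<Sum>u\<in>W. \<Sum>w\<in>W. c u * c w * gram q m u w)"
      by (simp add: sum_distrib_left)
    finally show "(\<Sum>u\<in>W. \<Sum>w\<in>W. c u * c w * gram q m u w) > 0"
      by (simp add: zero_less_mult_iff)
  qed
  then show ?thesis by (simp add: W_def)
qed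

text \<open>Words of different lengths are orthogonal, so the form is a sum over lengths. Each
  summand is a restriction of the form on all words of that length over the finitely many letters
  that occur.\<close>

lemma gram_pos_def_on:
  fixes q :: real
  assumes m: "m \<ge> 1" and q: "-1 < q" "q < 1" "1 + (real m - 1) * q > 0"
    and F: "finite F" "F \<subseteq> lists (gen_indices m)"
  shows "pos_def_on F (gram q m)"
  unfolding pos_def_on_def
proof (intro allI impI)
  fix c :: "(nat \<times> nat) list \<Rightarrow> real" assume "\<exists>u\<in>F. c u \<noteq> 0"
  then obtain u0 where u0: "u0 \<in> F" "c u0 \<noteq> 0" by blast
  define I where "I = fst ` (\<Union>u\<in>F. set u)"
  define G where "G n = {u \<in> F. length u = n}" for n
  define Q where "Q n = (\<Sum>u\<in>G n. \<Sum>w\<in>G n. c u * c w * gram q m u w)" for n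
  have I: "finite I" using F by (auto simp: I_def)
  have "set u \<subseteq> I \<times> {1..m}" if "u \<in> F" for u
  proof
    fix a assume a: "a \<in> set u"
    have "fst a \<in> I" using a that by (auto simp: I_def)
    moreover have "a \<in> gen_indices m" using a that F(2) by auto
    ultimately show "a \<in> I \<times> {1..m}" by (auto simp: gen_indices_def)
  qed
  then have pos: "pos_def_on (G n) (gram q m)" for n
    by (intro pos_def_on_pullback[OF gram_pos_def_on_length[OF m q I, of n], of "\<lambda>x. x"])
      (auto simp: G_def I finite_lists_length_eq)
  have "gram q m u w = 0" if "length w \<noteq> length u" for u w
    using that by (intro gram_length) auto
  then have "(\<Sum>u\<in>F. \<Sum>w\<in>F. c u * c w * gram q m u w) = (\<Sum>u\<in>F. \<Sum>w\<in>G (length u). c u * c w * gram q m u w)"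
    using F(1) by (intro sum.cong refl sum.mono_neutral_right) (auto simp: G_def)
  also have "\<dots> = (\<Sum>n\<in>length ` F. \<Sum>u\<in>G n. \<Sum>w\<in>G (length u). c u * c w * gram q m u w)"
    unfolding G_def using F(1) by (intro sum.group[symmetric]) auto
  also have "\<dots> = (\<Sum>n\<in>length ` F. Q n)"
    unfolding Q_def by (intro sum.cong refl) (auto simp: G_def)
  also have "\<dots> > 0"
  proof (rule sum_pos2)
    show "finite (length ` F)" "length u0 \<in> length ` F" using F u0 by auto
    show "Q (length u0) > 0" unfolding Q_def
      using u0 by (intro pos_def_onD[OF pos, of u0]) (auto simp: G_def)
    show "Q n \<ge> 0" for n unfolding Q_def by (rule pos_def_on_nonneg[OF pos])
  qed
  finally show "(\<Sum>u\<in>F. \<Sum>w\<in>F. c u * c w * gram q m u w) > 0" .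
qed

section \<open>Embedding a space of countable dimension into \<open>\<ell>\<^sup>2\<close>\<close>

locale inner_product =
  fixes S :: "'v::real_vector set" and B :: "'v \<Rightarrow> 'v \<Rightarrow> real"
  assumes inner_product_on: "inner_product_on S B"
begin

lemma subspace_S: "subspace S"
  and B_add: "x \<in> S \<Longrightarrow> y \<in> S \<Longrightarrow> z \<in> S \<Longrightarrow> B (x + y) z = B x z + B y z"
  and B_scale: "x \<in> S \<Longrightarrow> y \<in> S \<Longrightarrow> B (c *\<^sub>R x) y = c * B x y"
  and B_sym: "x \<in> S \<Longrightarrow> y \<in> S \<Longrightarrow> B x y = B y x"
  and B_pos: "x \<in> S \<Longrightarrow> x \<noteq> 0 \<Longrightarrow> B x x > 0"
  using inner_product_on by (auto simp: inner_product_on_def)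

lemmas S_closed = subspace_0[OF subspace_S] subspace_add[OF subspace_S] subspace_scale[OF subspace_S]
  subspace_diff[OF subspace_S] subspace_sum[OF subspace_S]

lemma B_zero: "x \<in> S \<Longrightarrow> B 0 x = 0"
  using B_scale[of x x 0] by simp

lemma B_sum:
  "(\<And>i. i \<in> I \<Longrightarrow> g i \<in> S) \<Longrightarrow> y \<in> S \<Longrightarrow> B (\<Sum>i\<in>I. r i *\<^sub>R g i) y = (\<Sum>i\<in>I. r i * B (g i) y)"
  by (induction I rule: infinite_finite_induct) (simp_all add: B_zero B_add B_scale S_closed)

lemma B_sum_right:
  assumes "\<And>i. i \<in> I \<Longrightarrow> g i \<in> S" "y \<in> S"
  shows "B y (\<Sum>i\<in>I. r i *\<^sub>R g i) = (\<Sum>i\<in>I. r i * B y (g i))"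
proof -
  have "B y (\<Sum>i\<in>I. r i *\<^sub>R g i) = B (\<Sum>i\<in>I. r i *\<^sub>R g i) y"
    using assms by (intro B_sym S_closed)
  then show ?thesis using assms by (simp add: B_sum B_sym[of y])
qed

lemma B_diff: "x \<in> S \<Longrightarrow> y \<in> S \<Longrightarrow> z \<in> S \<Longrightarrow> B z (x - y) = B z x - B z y"
  using B_add[of "x - y" y z] by (simp add: S_closed B_sym[of z])

end

function gram_schmidt :: "('v::real_vector \<Rightarrow> 'v \<Rightarrow> real) \<Rightarrow> (nat \<Rightarrow> 'v) \<Rightarrow> nat \<Rightarrow> 'v" where
  "gram_schmidt B e n =
    (let v = e n - (\<Sum>k\<in>{..<n}. B (gram_schmidt B e k) (e n) *\<^sub>R gram_schmidt B e k)
     in (1 / sqrt (B v v)) *\<^sub>R v)"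
  by pat_completeness auto
termination by (relation "Wellfounded.measure (\<lambda>(B, e, n). n)") auto

declare gram_schmidt.simps [simp del]

text \<open>\<open>J\<close> takes coordinates in the orthonormal basis obtained by Gram-Schmidt.
  Its image is the space of finitely supported sequences, which is dense because the basis is
  infinite.\<close>

lemma (in inner_product) pre_hilbert_on_span:
  fixes e :: "nat \<Rightarrow> 'v"
  assumes e: "inj e" "independent (range e)" and S: "S = span (range e)"
  shows "pre_hilbert_on S B"
proof -
  define f where "f = gram_schmidt B e"
  define v where "v n = e n - (\<Sum>k<n. B (f k) (e n) *\<^sub>R f k)" for n
  have f: "f n = (1 / sqrt (B (v n) (v n))) *\<^sub>R v n" for n
    unfolding f_def v_def by (subst gram_schmidt.simps) (simp add: Let_def)
  have eS: "e n \<in> S" for n unfolding S by (auto intro: span_base)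
  have f_span: "f n \<in> span (e ` {..n})" for n
  proof (induction n rule: less_induct)
    case (less n)
    have "f k \<in> span (e ` {..n})" if "k < n" for k
    proof -
      have "e ` {..k} \<subseteq> e ` {..n}" using that by (intro image_mono) auto
      then show ?thesis using less[OF that] span_mono by blast
    qed
    then have "v n \<in> span (e ` {..n})"
      unfolding v_def by (auto intro!: span_diff span_sum span_scale intro: span_base)
    then show ?case unfolding f by (rule span_scale)
  qed
  have fS: "f n \<in> S" for n
    using f_span[of n] span_mono[of "e ` {..n}" "range e"] by (auto simp: S)
  have vS: "v n \<in> S" for n unfolding v_def by (intro S_closed eS fS)
  \<comment> \<open>Otherwise \<open>e n\<close> would lie in the span of its predecessors.\<close>
  have "v n \<noteq> 0" for n
  proof
    assume "v n = 0"
    then have "e n = (\<Sum>k<n. B (f k) (e n) *\<^sub>R f k)" by (simp add: v_def)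
    moreover have "f k \<in> span (range e - {e n})" if "k < n" for k
    proof -
      have "e ` {..k} \<subseteq> range e - {e n}" using that injD[OF e(1)] by fastforce
      then show ?thesis using f_span[of k] span_mono by blast
    qed
    then have "(\<Sum>k<n. B (f k) (e n) *\<^sub>R f k) \<in> span (range e - {e n})"
      by (intro span_sum span_scale) auto
    ultimately have "e n \<in> span (range e - {e n})" by simp
    then show False using e(2) by (auto simp: dependent_def)
  qed
  then have v_pos: "B (v n) (v n) > 0" for n using B_pos vS by blast
  have f_norm: "B (f n) (f n) = 1" for n
  proof -
    have "B (f n) (f n) = (1 / sqrt (B (v n) (v n))) * ((1 / sqrt (B (v n) (v n))) * B (v n) (v n))"
      unfolding f using vS by (simp add: B_scale B_sym[of "v n" "_ *\<^sub>R v n"] S_closed)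
    then show ?thesis using v_pos[of n] by (simp add: real_div_sqrt less_imp_le)
  qed
  have f_orth: "B (f j) (f n) = 0" if "j < n" for j n
    using that
  proof (induction n arbitrary: j rule: less_induct)
    case (less n)
    have *: "B (f j) (f k) = (if k = j then 1 else 0)" if "k < n" for k
      using less.IH[of k j] less.IH[of j k] that less.prems f_norm B_sym[OF fS fS, of k j]
      by (cases j k rule: linorder_cases) auto
    have "B (f j) (v n) = B (f j) (e n) - (\<Sum>k<n. B (f k) (e n) * B (f j) (f k))"
      unfolding v_def using fS eS by (simp add: B_diff S_closed B_sum_right)
    also have "(\<Sum>k<n. B (f k) (e n) * B (f j) (f k)) = (\<Sum>k<n. if k = j then B (f j) (e n) else 0)"
      by (intro sum.cong refl) (auto simp: *)
    finally have "B (f j) (v n) = 0" using less.prems by simp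
    then show ?case
      unfolding f[of n] using B_scale[OF vS fS] B_sym[OF fS S_closed(3)[OF vS]] B_sym[OF fS vS] by simp
  qed
  have orth: "B (f i) (f j) = (if i = j then 1 else 0)" for i j
    using f_orth[of i j] f_orth[of j i] f_norm B_sym[OF fS fS, of i j] by (cases i j rule: linorder_cases) auto
  \<comment> \<open>Vectors with a finite expansion. Asking for all large \<open>M\<close> lets two
    expansions share a cutoff, so that \<open>X\<close> is a subspace; it contains every
    \<open>e n\<close> and hence \<open>S\<close>.\<close>
  define X where "X = {x \<in> S. \<exists>N. \<forall>M\<ge>N. x = (\<Sum>k<M. B (f k) x *\<^sub>R f k)}"
  have X: "subspace X"
    unfolding subspace_def
  proof (intro conjI ballI allI)
    show "0 \<in> X" using B_zero[OF fS] B_sym[OF S_closed(1) fS] by (simp add: X_def S_closed)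
    fix x assume "x \<in> X"
    then obtain N where x: "x \<in> S" "\<And>M. M \<ge> N \<Longrightarrow> x = (\<Sum>k<M. B (f k) x *\<^sub>R f k)" by (auto simp: X_def)
    show "c *\<^sub>R x \<in> X" for c
    proof -
      have "B (f k) (c *\<^sub>R x) = c * B (f k) x" for k
        using B_scale[OF x(1) fS] by (simp add: B_sym[OF fS] x S_closed)
      then have "c *\<^sub>R x = (\<Sum>k<M. B (f k) (c *\<^sub>R x) *\<^sub>R f k)" if "M \<ge> N" for M
        using arg_cong[OF x(2)[OF that], of "(*\<^sub>R) c"] by (simp add: scaleR_sum_right)
      then show ?thesis using x(1) by (auto simp: X_def S_closed)
    qed
    fix y assume "y \<in> X"
    then obtain N' where y: "y \<in> S" "\<And>M. M \<ge> N' \<Longrightarrow> y = (\<Sum>k<M. B (f k) y *\<^sub>R f k)" by (auto simp: X_def)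
    have "B (f k) (x + y) = B (f k) x + B (f k) y" for k
      using B_add[OF x(1) y(1) fS] by (simp add: B_sym[OF fS] x y S_closed)
    then have "x + y = (\<Sum>k<M. B (f k) (x + y) *\<^sub>R f k)" if "M \<ge> max N N'" for M
      using arg_cong2[OF x(2)[of M] y(2)[of M], of "(+)"] that by (simp add: scaleR_left_distrib sum.distrib)
    then show "x + y \<in> X" using x(1) y(1) unfolding X_def by (blast intro: S_closed)
  qed
  have fX: "f n \<in> X" for n
  proof -
    have "f n = (\<Sum>k<M. B (f k) (f n) *\<^sub>R f k)" if "M \<ge> Suc n" for M
    proof -
      have "(\<Sum>k<M. B (f k) (f n) *\<^sub>R f k) = (\<Sum>k<M. if k = n then f n else 0)"
        by (intro sum.cong refl) (auto simp: orth)
      then show ?thesis using that by simp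
    qed
    then show ?thesis using fS unfolding X_def by blast
  qed
  have "e n \<in> X" for n
  proof -
    have "v n = sqrt (B (v n) (v n)) *\<^sub>R f n" using v_pos[of n] by (simp add: f)
    then have "e n = sqrt (B (v n) (v n)) *\<^sub>R f n + (\<Sum>k<n. B (f k) (e n) *\<^sub>R f k)"
      by (simp add: v_def)
    moreover have "\<dots> \<in> X" by (intro subspace_add subspace_sum subspace_scale X fX)
    ultimately show ?thesis by simp
  qed
  then have SX: "S \<subseteq> X" unfolding S by (intro span_minimal X) auto
  have expand: "\<exists>N. \<forall>M\<ge>N. x = (\<Sum>k<M. B (f k) x *\<^sub>R f k)" if "x \<in> S" for x
    using SX that by (auto simp: X_def)
  have coeff: "B (f n) (\<Sum>k<M. r k *\<^sub>R f k) = (if n < M then r n else 0)" for n M r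
  proof -
    have "B (f n) (\<Sum>k<M. r k *\<^sub>R f k) = (\<Sum>k<M. r k * B (f n) (f k))"
      by (rule B_sum_right) (auto intro: fS)
    also have "\<dots> = (\<Sum>k<M. if k = n then r n else 0)"
      by (intro sum.cong refl) (auto simp: orth)
    finally show ?thesis by simp
  qed
  have fin_supp: "\<exists>N. \<forall>n\<ge>N. B (f n) x = 0" if "x \<in> S" for x
  proof -
    obtain N where N: "x = (\<Sum>k<N. B (f k) x *\<^sub>R f k)" using expand[OF \<open>x \<in> S\<close>] by blast
    have "B (f n) x = 0" if "n \<ge> N" for n
      using that by (subst N) (simp add: coeff)
    then show ?thesis by blast
  qed
  \<comment> \<open>Meaningful on \<open>S\<close> only, where the coordinate sequences have finite
    support.\<close>
  define J where "J x = Abs_ell2 (\<lambda>n. B (f n) x)" for x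
  have J: "ell2_nth (J x) n = B (f n) x" if x: "x \<in> S" for x n
  proof -
    obtain N where "\<And>n. n \<ge> N \<Longrightarrow> B (f n) x = 0" using fin_supp[OF x] by blast
    then have "summable (\<lambda>n. (B (f n) x)\<^sup>2)"
      by (intro summable_finite[of "{..<N}"]) (auto simp: not_less)
    then show ?thesis by (simp add: J_def Abs_ell2_inverse)
  qed
  have J_add: "J (x + y) = J x + J y" if "x \<in> S" "y \<in> S" for x y
    using that B_add[OF that fS]
    by (intro ell2_eqI) (simp add: J S_closed plus_ell2.rep_eq B_sym[OF fS])
  have J_scale: "J (c *\<^sub>R x) = c *\<^sub>R J x" if "x \<in> S" for c x
    using that B_scale[OF that fS]
    by (intro ell2_eqI) (simp add: J S_closed scaleR_ell2.rep_eq B_sym[OF fS])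
  have J_inner: "inner (J x) (J y) = B x y" if x: "x \<in> S" and y: "y \<in> S" for x y
  proof -
    obtain N where N: "\<And>n. n \<ge> N \<Longrightarrow> B (f n) x = 0" using fin_supp[OF x] by blast
    obtain N' where N': "\<And>M. M \<ge> N' \<Longrightarrow> x = (\<Sum>k<M. B (f k) x *\<^sub>R f k)" using expand[OF x] by blast
    define M where "M = max N N'"
    have "inner (J x) (J y) = (\<Sum>n<M. B (f n) x * B (f n) y)"
      unfolding inner_ell2_def J[OF x] J[OF y] by (rule suminf_finite) (auto simp: M_def N)
    also have "\<dots> = B (\<Sum>k<M. B (f k) x *\<^sub>R f k) y"
      by (rule B_sum[symmetric]) (auto intro: fS y)
    also have "(\<Sum>k<M. B (f k) x *\<^sub>R f k) = x" using N'[of M] by (simp add: M_def)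
    finally show ?thesis .
  qed
  \<comment> \<open>Truncations of \<open>y\<close> are coordinates of finite combinations of the
    \<open>f k\<close>; the squared distance to \<open>y\<close> is the tail of a convergent
    series.\<close>
  have "y \<in> closure (J ` S)" for y
    unfolding closure_sequential
  proof (intro exI conjI allI)
    define x where "x N = (\<Sum>k<N. ell2_nth y k *\<^sub>R f k)" for N
    have xS: "x N \<in> S" for N unfolding x_def by (intro S_closed fS)
    show "J (x N) \<in> J ` S" for N using xS by blast
    have nth: "ell2_nth (J (x N)) n = (if n < N then ell2_nth y n else 0)" for N n
      by (simp add: J xS) (simp add: x_def coeff)
    have norm: "(norm (J (x N) - y))\<^sup>2 = suminf (\<lambda>n. (ell2_nth y n)\<^sup>2) - (\<Sum>n<N. (ell2_nth y n)\<^sup>2)" for N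
    proof -
      have "(\<lambda>n. (if n < N then (ell2_nth y n)\<^sup>2 else 0)) sums (\<Sum>n<N. (ell2_nth y n)\<^sup>2)"
        using sums_If_finite_set[of "{..<N}" "\<lambda>n. (ell2_nth y n)\<^sup>2"] by simp
      then have "(\<lambda>n. (ell2_nth y n)\<^sup>2 - (if n < N then (ell2_nth y n)\<^sup>2 else 0)) sums
         (suminf (\<lambda>n. (ell2_nth y n)\<^sup>2) - (\<Sum>n<N. (ell2_nth y n)\<^sup>2))"
        by (intro sums_diff summable_sums ell2_summable)
      moreover have "(ell2_nth y n)\<^sup>2 - (if n < N then (ell2_nth y n)\<^sup>2 else 0) =
          ell2_nth (J (x N) - y) n * ell2_nth (J (x N) - y) n" for n
        by (simp add: minus_ell2.rep_eq nth power2_eq_square)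
      ultimately show ?thesis
        unfolding power2_norm_eq_inner inner_ell2_def by (simp add: sums_iff)
    qed
    have "(\<lambda>N. (norm (J (x N) - y))\<^sup>2) \<longlonglongrightarrow> suminf (\<lambda>n. (ell2_nth y n)\<^sup>2) - suminf (\<lambda>n. (ell2_nth y n)\<^sup>2)"
      unfolding norm by (intro tendsto_diff tendsto_const summable_LIMSEQ ell2_summable)
    then have "(\<lambda>N. sqrt ((norm (J (x N) - y))\<^sup>2)) \<longlonglongrightarrow> sqrt 0"
      by (intro tendsto_real_sqrt) simp
    then show "(\<lambda>N. J (x N)) \<longlonglongrightarrow> y"
      by (auto intro: LIM_zero_cancel dest: tendsto_norm_zero_cancel)
  qed
  then have "closure (J ` S) = UNIV" by blast
  then show ?thesis
    unfolding pre_hilbert_on_def using inner_product_on J_add J_scale J_inner by blast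
qed

section \<open>The vacuum expectation\<close>

definition word_extend :: "(quon_gen list \<Rightarrow> Rq) \<Rightarrow> quon_poly \<Rightarrow> Rq" where
  "word_extend F x = (\<Sum>w\<in>Poly_Mapping.keys x. Poly_Mapping.lookup x w * F w)"

lemma word_extend_superset:
  assumes "finite K" "Poly_Mapping.keys x \<subseteq> K"
  shows "word_extend F x = (\<Sum>w\<in>K. Poly_Mapping.lookup x w * F w)"
  unfolding word_extend_def using assms
  by (intro sum.mono_neutral_left) (auto simp: in_keys_iff)

lemma word_extend_zero [simp]: "word_extend F 0 = 0"
  by (simp add: word_extend_def)

lemma word_extend_single [simp]: "word_extend F (Poly_Mapping.single w c) = c * F w"
  by (subst word_extend_superset[of "{w}"]) auto

lemma word_extend_add: "word_extend F (x + y) = word_extend F x + word_extend F y"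
proof -
  let ?K = "Poly_Mapping.keys x \<union> Poly_Mapping.keys y"
  have "Poly_Mapping.keys (x + y) \<subseteq> ?K" by (rule Poly_Mapping.keys_add)
  then show ?thesis
    by (simp add: word_extend_superset[of ?K] lookup_add distrib_right sum.distrib)
qed

lemma word_extend_minus: "word_extend F (x - y) = word_extend F x - word_extend F y"
  using word_extend_add[of F "x - y" y] by simp

lemma word_extend_sum: "word_extend F (\<Sum>i\<in>I. g i) = (\<Sum>i\<in>I. word_extend F (g i))"
  by (induction I rule: infinite_finite_induct) (simp_all add: word_extend_add)

lemma sum_single: "x = (\<Sum>w\<in>Poly_Mapping.keys x. Poly_Mapping.single w (Poly_Mapping.lookup x w))"
  by (rule poly_mapping_eqI) (auto simp: lookup_sum lookup_single when_def in_keys_iff)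

lemma plus_list_append [simp]: "(u :: 'a list) + v = u @ v"
  by (simp add: plus_list_def)

lemma one_eq_single: "(1 :: quon_poly) = Poly_Mapping.single [] 1"
  by (simp flip: zero_list_def single_one)

lemma word_extend_mult_left_right:
  "word_extend F (x * r * y) = (\<Sum>u\<in>Poly_Mapping.keys x. \<Sum>w\<in>Poly_Mapping.keys y.
     word_extend F (Poly_Mapping.single u (Poly_Mapping.lookup x u) * r * Poly_Mapping.single w (Poly_Mapping.lookup y w)))"
proof -
  have "x * r * y = (\<Sum>u\<in>Poly_Mapping.keys x. \<Sum>w\<in>Poly_Mapping.keys y.
     Poly_Mapping.single u (Poly_Mapping.lookup x u) * r * Poly_Mapping.single w (Poly_Mapping.lookup y w))"
    by (subst (1) sum_single[of x], subst (1) sum_single[of y]) (simp add: sum_distrib_left sum_distrib_right, rule sum.swap)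
  then show ?thesis by (simp add: word_extend_sum)
qed

lemma word_extend_mult:
  "word_extend F (x * y) = (\<Sum>u\<in>Poly_Mapping.keys x. \<Sum>w\<in>Poly_Mapping.keys y.
     Poly_Mapping.lookup x u * Poly_Mapping.lookup y w * F (u @ w))"
  using word_extend_mult_left_right[of F x 1 y] by (simp add: mult_single)

lemma word_extend_scal: "word_extend F (scal c * x) = c * word_extend F x"
  by (cases "c = 0")
    (simp_all add: scal_def word_extend_mult, simp add: word_extend_def sum_distrib_left mult.assoc)

text \<open>By bilinearity, vanishing on the ideal need only be checked on these multiples of a
  relator by monomials.\<close>

lemma single_relator_single:
  "Poly_Mapping.single u c * relator m (i, k) (j, l) * Poly_Mapping.single v d =
     Poly_Mapping.single (u @ Ann j l # Cre i k # v) (c * d)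
     - (Poly_Mapping.single (u @ Cre i k # Ann j l # v) (c * d * qvar)
        + Poly_Mapping.single (u @ v) (c * d * (qvar ^ qbeta m k l * (if i = j then 1 else 0))))"
  unfolding relator_def prod.case gen_def scal_def
  by (simp add: mult_single left_diff_distrib right_diff_distrib distrib_left distrib_right mult_ac
      del: single_uminus)

lemma free_alg_iff: "x \<in> free_alg m \<longleftrightarrow> (\<forall>w. Poly_Mapping.lookup x w \<noteq> 0 \<longrightarrow> w \<in> lists (quon_gens m))"
  by (auto simp: free_alg_def in_keys_iff)

lemma free_alg_keysD: "x \<in> free_alg m \<Longrightarrow> w \<in> Poly_Mapping.keys x \<Longrightarrow> w \<in> lists (quon_gens m)"
  by (auto simp: free_alg_def)

lemma free_alg_zero [simp]: "0 \<in> free_alg m"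
  by (simp add: free_alg_def)

lemma free_alg_add: "x \<in> free_alg m \<Longrightarrow> y \<in> free_alg m \<Longrightarrow> x + y \<in> free_alg m"
  using Poly_Mapping.keys_add[of x y] by (auto simp: free_alg_def)

lemma free_alg_minus: "x \<in> free_alg m \<Longrightarrow> y \<in> free_alg m \<Longrightarrow> x - y \<in> free_alg m"
  unfolding free_alg_iff lookup_minus by (metis diff_zero)

lemma free_alg_mult: "x \<in> free_alg m \<Longrightarrow> y \<in> free_alg m \<Longrightarrow> x * y \<in> free_alg m"
  using keys_mult[of x y] by (fastforce simp: free_alg_def)

lemma free_alg_single: "w \<in> lists (quon_gens m) \<Longrightarrow> Poly_Mapping.single w c \<in> free_alg m"
  by (auto simp: free_alg_def)

lemma free_alg_scal: "scal c \<in> free_alg m"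
  by (simp add: scal_def free_alg_single)

lemma free_alg_gen: "g \<in> quon_gens m \<Longrightarrow> gen g \<in> free_alg m"
  by (simp add: gen_def free_alg_single)

lemma free_alg_sum: "(\<And>i. i \<in> I \<Longrightarrow> g i \<in> free_alg m) \<Longrightarrow> (\<Sum>i\<in>I. g i) \<in> free_alg m"
  by (induction I rule: infinite_finite_induct) (simp_all add: free_alg_add)

lemma relator_in_free_alg:
  "s \<in> gen_indices m \<Longrightarrow> t \<in> gen_indices m \<Longrightarrow> relator m s t \<in> free_alg m"
  by (cases s; cases t)
    (auto simp: relator_def intro!: free_alg_minus free_alg_add free_alg_mult free_alg_scal free_alg_gen)

lemma quon_ideal_subset: "x \<in> quon_ideal m \<Longrightarrow> x \<in> free_alg m"
  by (induction rule: quon_ideal.induct) (auto intro!: free_alg_add free_alg_mult relator_in_free_alg)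

lemma dag_in_free_alg: "x \<in> free_alg m \<Longrightarrow> dag x \<in> free_alg m"
  unfolding dag_def
  by (intro free_alg_sum free_alg_single) (auto dest!: free_alg_keysD simp flip: dag_word_def)

definition quon_vacuum :: "nat \<Rightarrow> quon_poly \<Rightarrow> Rq" where
  "quon_vacuum m = restrict (word_extend (vacuum_value qvar m)) (free_alg m)"

lemma word_extend_vacuum_ideal:
  "x \<in> quon_ideal m \<Longrightarrow> word_extend (vacuum_value qvar m) x = 0"
proof (induction rule: quon_ideal.induct)
  case (add x u v s t)
  obtain i k j l where st: "s = (i, k)" "t = (j, l)" by (cases s, cases t)
  have "word_extend (vacuum_value qvar m) (Poly_Mapping.single a c * relator m s t * Poly_Mapping.single b d) = 0" for a b c d
    unfolding st single_relator_single
    by (cases "i = j") (simp_all add: word_extend_minus word_extend_add vacuum_value_relation distrib_left mult.assoc)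
  then have "word_extend (vacuum_value qvar m) (u * relator m s t * v) = 0"
    by (simp add: word_extend_mult_left_right[of _ u _ v])
  then show ?case using add.IH by (simp add: word_extend_add)
qed simp

lemma is_vacuum_expectation_quon_vacuum: "is_vacuum_expectation m (quon_vacuum m)"
  unfolding is_vacuum_expectation_def
proof (intro conjI ballI allI)
  show "quon_vacuum m \<in> extensional (free_alg m)"
    by (simp add: quon_vacuum_def)
next
  fix x y assume "x \<in> free_alg m" "y \<in> free_alg m"
  then show "quon_vacuum m (x + y) = quon_vacuum m x + quon_vacuum m y"
    by (simp add: quon_vacuum_def free_alg_add word_extend_add)
next
  fix c x assume "x \<in> free_alg m"
  then show "quon_vacuum m (scal c * x) = c * quon_vacuum m x"
    by (simp add: quon_vacuum_def free_alg_mult free_alg_scal word_extend_scal)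
next
  fix x assume "x \<in> quon_ideal m"
  then show "quon_vacuum m x = 0"
    by (simp add: quon_vacuum_def quon_ideal_subset word_extend_vacuum_ideal)
next
  show "quon_vacuum m 1 = 1"
    by (simp add: quon_vacuum_def one_eq_single free_alg_single)
next
  fix s assume "s \<in> gen_indices m"
  then show "case s of (i, k) \<Rightarrow> \<forall>x\<in>free_alg m. quon_vacuum m (x * gen (Ann i k)) = 0"
    by (auto simp: quon_vacuum_def free_alg_mult free_alg_gen) (auto simp: word_extend_mult gen_def)
next
  fix s assume "s \<in> gen_indices m"
  then show "case s of (i, k) \<Rightarrow> \<forall>x\<in>free_alg m. quon_vacuum m (gen (Cre i k) * x) = 0"
    by (auto simp: quon_vacuum_def free_alg_mult free_alg_gen) (auto simp: word_extend_mult gen_def)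
qed

text \<open>Linearity reduces the claim to words, and normal ordering to creation words; there the
  value is 1 at the empty word and 0 behind a leading creator.\<close>

lemma vacuum_expectation_unique:
  assumes \<phi>: "is_vacuum_expectation m \<phi>"
  shows "\<phi> = quon_vacuum m"
proof (rule extensionalityI[of _ "free_alg m"])
  show "\<phi> \<in> extensional (free_alg m)" using \<phi> by (simp add: is_vacuum_expectation_def)
  show "quon_vacuum m \<in> extensional (free_alg m)" by (simp add: quon_vacuum_def)
next
  have add: "\<phi> (x + y) = \<phi> x + \<phi> y" if "x \<in> free_alg m" "y \<in> free_alg m" for x y
    using \<phi> that by (simp add: is_vacuum_expectation_def)
  have scale: "\<phi> (scal c * x) = c * \<phi> x" if "x \<in> free_alg m" for c x
    using \<phi> that by (simp add: is_vacuum_expectation_def)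
  have ideal: "\<phi> x = 0" if "x \<in> quon_ideal m" for x
    using \<phi> that by (simp add: is_vacuum_expectation_def)
  have one: "\<phi> 1 = 1" using \<phi> by (simp add: is_vacuum_expectation_def)
  have ann: "\<phi> (x * gen (Ann i k)) = 0" if "(i, k) \<in> gen_indices m" "x \<in> free_alg m" for x i k
    using \<phi> that unfolding is_vacuum_expectation_def by fast
  have cre: "\<phi> (gen (Cre i k) * x) = 0" if "(i, k) \<in> gen_indices m" "x \<in> free_alg m" for x i k
    using \<phi> that unfolding is_vacuum_expectation_def by fast
  have zero: "\<phi> 0 = 0" by (rule ideal) (rule quon_ideal.zero)
  have sum: "\<phi> (\<Sum>i\<in>I. g i) = (\<Sum>i\<in>I. \<phi> (g i))" if "\<And>i. i \<in> I \<Longrightarrow> g i \<in> free_alg m"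
    for I :: "quon_gen list set" and g
    using that by (induction I rule: infinite_finite_induct) (simp_all add: zero add free_alg_sum)
  define f where "f w = \<phi> (Poly_Mapping.single w 1)" for w
  have single: "\<phi> (Poly_Mapping.single w c) = c * f w" if "w \<in> lists (quon_gens m)" for w c
    using scale[of "Poly_Mapping.single w 1" c] that by (simp add: f_def free_alg_single scal_def mult_single)
  have f: "f w = vacuum_value qvar m w" if w: "w \<in> lists (quon_gens m)" for w
  proof -
    have "f w = dual_word ((*) qvar) m w (\<lambda>c. f (cre_word c)) []"
    proof (rule linear_twist.dual_word_normal_order[OF linear_twist_times _ _ w])
      fix u v i k j l
      assume uv: "u \<in> lists (quon_gens m)" "v \<in> lists (quon_gens m)"
        and ik: "(i, k) \<in> gen_indices m" and jl: "(j, l) \<in> gen_indices m"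
      let ?r = "Poly_Mapping.single u 1 * relator m (i, k) (j, l) * Poly_Mapping.single v 1"
      let ?y = "Poly_Mapping.single (u @ Cre i k # Ann j l # v) qvar"
      let ?z = "Poly_Mapping.single (u @ v) (qvar ^ qbeta m k l * (if i = j then 1 else 0))"
      \<comment> \<open>The ideal is generated by adding multiples of relators to known members, so
        a single multiple enters as a summand of 0.\<close>
      have "0 + ?r \<in> quon_ideal m"
        using uv ik jl by (intro quon_ideal.intros free_alg_single)
      then have r: "?r \<in> quon_ideal m" by simp
      have "Poly_Mapping.single (u @ Ann j l # Cre i k # v) 1 = ?r + (?y + ?z)"
        unfolding single_relator_single by simp
      then have "f (u @ Ann j l # Cre i k # v) = \<phi> (?r + (?y + ?z))" by (simp add: f_def)
      also have "\<dots> = \<phi> ?r + (\<phi> ?y + \<phi> ?z)"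
      proof -
        have "?y \<in> free_alg m" "?z \<in> free_alg m" using uv ik jl by (auto intro!: free_alg_single)
        then show ?thesis using quon_ideal_subset[OF r] by (simp only: add free_alg_add)
      qed
      also have "\<phi> ?r = 0" by (rule ideal[OF r])
      finally show "f (u @ Ann j l # Cre i k # v) =
          qvar * f (u @ Cre i k # Ann j l # v) + (if i = j then ((*) qvar ^^ qbeta m k l) (f (u @ v)) else 0)"
        using uv ik jl by (simp add: single funpow_times)
    next
      fix u j l assume "u \<in> lists (quon_gens m)" "(j, l) \<in> gen_indices m"
      then show "f (u @ [Ann j l]) = 0"
        using ann[of j l "Poly_Mapping.single u 1"] by (simp add: f_def gen_def mult_single free_alg_single)
    qed
    also have "\<dots> = vacuum_value qvar m w"
      unfolding vacuum_value_def
    proof (rule dual_word_cong[OF w])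
      fix c assume c: "c \<in> lists (gen_indices m)"
      show "f (cre_word c) = (if c = [] then 1 else 0)"
      proof (cases c)
        case Nil
        then show ?thesis using one by (simp add: f_def one_eq_single)
      next
        case (Cons b d)
        then show ?thesis
          using cre[of "fst b" "snd b" "Poly_Mapping.single (cre_word d) 1"] c
          by (simp add: f_def gen_def mult_single free_alg_single)
      qed
    qed simp
    finally show ?thesis .
  qed
  fix x assume x: "x \<in> free_alg m"
  have "\<phi> x = (\<Sum>w\<in>Poly_Mapping.keys x. \<phi> (Poly_Mapping.single w (Poly_Mapping.lookup x w)))"
    by (subst (1) sum_single[of x], rule sum) (use x in \<open>auto intro: free_alg_single dest: free_alg_keysD\<close>)
  also have "\<dots> = (\<Sum>w\<in>Poly_Mapping.keys x. Poly_Mapping.lookup x w * vacuum_value qvar m w)"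
    by (intro sum.cong refl) (simp add: single f free_alg_keysD[OF x])
  finally show "\<phi> x = quon_vacuum m x" using x by (simp add: quon_vacuum_def word_extend_def)
qed

lemma vac_exp_eq: "vac_exp m = quon_vacuum m"
  unfolding vac_exp_def
  by (rule the_equality) (auto intro: is_vacuum_expectation_quon_vacuum vacuum_expectation_unique)

lemma word_extend_dag_mult:
  "word_extend F (dag a * b) = (\<Sum>u\<in>Poly_Mapping.keys a. \<Sum>w\<in>Poly_Mapping.keys b.
     Poly_Mapping.lookup a u * Poly_Mapping.lookup b w * F (dag_word u @ w))"
proof -
  have "dag a * b = (\<Sum>u\<in>Poly_Mapping.keys a. Poly_Mapping.single (dag_word u) (Poly_Mapping.lookup a u) * b)"
    by (simp add: dag_def dag_word_def sum_distrib_right)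
  moreover have "word_extend F (Poly_Mapping.single v c * b) =
      (\<Sum>w\<in>Poly_Mapping.keys b. c * Poly_Mapping.lookup b w * F (v @ w))" for v c
    by (simp add: word_extend_mult)
  ultimately show ?thesis by (simp add: word_extend_sum)
qed

section \<open>Evaluation of coefficients at a real value of q\<close>

lemma regular_at_cases:
  assumes "regular_at q r"
  obtains n d where "r = Fract n d" "poly d q \<noteq> 0" "d \<noteq> 0"
  using assms by (fastforce simp: regular_at_def)

lemma regular_at_Fract_1 [simp]: "regular_at q (Fract p 1)"
  and eval_at_Fract_1 [simp]: "eval_at q (Fract p 1) = poly p q"
  by (fastforce simp: regular_at_def) (simp add: eval_at_Fract)

lemma regular_at_0 [simp]: "regular_at q 0" and eval_at_0 [simp]: "eval_at q 0 = 0"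
  using regular_at_Fract_1[of q 0] eval_at_Fract_1[of q 0] by (simp_all add: fract_collapse)

lemma regular_at_add: "regular_at q r \<Longrightarrow> regular_at q s \<Longrightarrow> regular_at q (r + s)"
  and eval_at_add: "regular_at q r \<Longrightarrow> regular_at q s \<Longrightarrow> eval_at q (r + s) = eval_at q r + eval_at q s"
proof -
  assume "regular_at q r" "regular_at q s"
  then obtain n d n' d' where rs: "r = Fract n d" "poly d q \<noteq> 0" "d \<noteq> 0"
    "s = Fract n' d'" "poly d' q \<noteq> 0" "d' \<noteq> 0"
    by (metis regular_at_cases)
  have nz: "poly (d * d') q \<noteq> 0" using rs by simp
  have eq: "r + s = Fract (n * d' + n' * d) (d * d')" using rs by simp
  show "regular_at q (r + s)" unfolding regular_at_def eq using nz by blast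
  show "eval_at q (r + s) = eval_at q r + eval_at q s"
    unfolding eq eval_at_Fract[OF nz] using rs by (simp add: eval_at_Fract field_simps)
qed

lemma regular_at_mult: "regular_at q r \<Longrightarrow> regular_at q s \<Longrightarrow> regular_at q (r * s)"
  and eval_at_mult: "regular_at q r \<Longrightarrow> regular_at q s \<Longrightarrow> eval_at q (r * s) = eval_at q r * eval_at q s"
proof -
  assume "regular_at q r" "regular_at q s"
  then obtain n d n' d' where rs: "r = Fract n d" "poly d q \<noteq> 0"
    "s = Fract n' d'" "poly d' q \<noteq> 0"
    by (metis regular_at_cases)
  have nz: "poly (d * d') q \<noteq> 0" using rs by simp
  have eq: "r * s = Fract (n * n') (d * d')" using rs by simp
  show "regular_at q (r * s)" unfolding regular_at_def eq using nz by blast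
  show "eval_at q (r * s) = eval_at q r * eval_at q s"
    unfolding eq eval_at_Fract[OF nz] using rs by (simp add: eval_at_Fract)
qed

lemma regular_at_sum: "(\<And>i. i \<in> I \<Longrightarrow> regular_at q (g i)) \<Longrightarrow> regular_at q (\<Sum>i\<in>I. g i)"
  by (induction I rule: infinite_finite_induct) (simp_all add: regular_at_add)

lemma eval_at_sum: "(\<And>i. i \<in> I \<Longrightarrow> regular_at q (g i)) \<Longrightarrow> eval_at q (\<Sum>i\<in>I. g i) = (\<Sum>i\<in>I. eval_at q (g i))"
  by (induction I rule: infinite_finite_induct) (simp_all add: eval_at_add regular_at_sum)

text \<open>Normal ordering creates no denominators, so the expectation of a word is a polynomial
  and has no pole at any real \<open>q\<close>.\<close>

lemma vacuum_value_qvar: "vacuum_value qvar m w = Fract (vacuum_value [:0, 1:] m w) 1"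
proof (rule vacuum_value_hom[symmetric, of "\<lambda>p. Fract p 1"])
  show "Fract 0 1 = (0 :: Rq)" by (rule fract_collapse)
  show "Fract 1 1 = (1 :: Rq)" by (rule One_fract_def[symmetric])
  show "Fract (x + y) 1 = Fract x 1 + Fract y (1 :: real poly)" for x y by simp
  show "Fract ([:0, 1:] * x) 1 = qvar * Fract x (1 :: real poly)" for x
    by (simp only: qvar_def mult_fract mult_1_right)
qed

lemma regular_at_vacuum_value: "regular_at q (vacuum_value qvar m w)"
  by (simp add: vacuum_value_qvar)

lemma eval_at_vacuum_value: "eval_at q (vacuum_value qvar m w) = vacuum_value q m w"
  unfolding vacuum_value_qvar eval_at_Fract_1
  by (rule vacuum_value_hom[of "\<lambda>p. poly p q"]) simp_all

lemma regular_at_vac_exp: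
  assumes "a \<in> regular_alg q m" "b \<in> regular_alg q m"
  shows "regular_at q (vac_exp m (dag a * b))"
    and "eval_at q (vac_exp m (dag a * b)) = (\<Sum>u\<in>Poly_Mapping.keys a. \<Sum>w\<in>Poly_Mapping.keys b.
      eval_at q (Poly_Mapping.lookup a u) * eval_at q (Poly_Mapping.lookup b w) * vacuum_value q m (dag_word u @ w))"
proof -
  have ab: "a \<in> free_alg m" "b \<in> free_alg m"
    and reg: "\<And>w. regular_at q (Poly_Mapping.lookup a w)" "\<And>w. regular_at q (Poly_Mapping.lookup b w)"
    using assms by (auto simp: regular_alg_def)
  have eq: "vac_exp m (dag a * b) = (\<Sum>u\<in>Poly_Mapping.keys a. \<Sum>w\<in>Poly_Mapping.keys b.
     Poly_Mapping.lookup a u * Poly_Mapping.lookup b w * vacuum_value qvar m (dag_word u @ w))"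
    using ab by (simp add: vac_exp_eq quon_vacuum_def free_alg_mult dag_in_free_alg word_extend_dag_mult)
  note regs = regular_at_sum regular_at_mult reg regular_at_vacuum_value
  show "regular_at q (vac_exp m (dag a * b))"
    unfolding eq by (intro regs)
  show "eval_at q (vac_exp m (dag a * b)) = (\<Sum>u\<in>Poly_Mapping.keys a. \<Sum>w\<in>Poly_Mapping.keys b.
      eval_at q (Poly_Mapping.lookup a u) * eval_at q (Poly_Mapping.lookup b w) * vacuum_value q m (dag_word u @ w))"
    unfolding eq by (simp add: eval_at_sum eval_at_mult regs eval_at_vacuum_value)
qed

section \<open>Fock-like representations\<close>

lemma contract_closed:
  fixes s :: "'b \<Rightarrow> 'b::comm_monoid_add"
  assumes P: "P 0" "\<And>x y. P x \<Longrightarrow> P y \<Longrightarrow> P (x + y)" "\<And>x. P x \<Longrightarrow> P (s x)"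
    and "\<And>d. set d \<subseteq> set c \<Longrightarrow> P (f d)"
  shows "P (contract s m a f c)"
  using assms(4)
proof (induction c arbitrary: f)
  case (Cons b c)
  have pow: "P ((s ^^ n) x)" if "P x" for n x
    using that P(3) by (induction n) auto
  have "P (contract s m a (\<lambda>d. f (b # d)) c)"
    by (rule Cons.IH) (rule Cons.prems, auto)
  moreover have "P (f c)" by (rule Cons.prems) auto
  ultimately show ?case using P pow by simp
qed (use P in simp)

text \<open>Normal ordering only adds values and applies \<open>s\<close>.\<close>

lemma dual_word_closed:
  fixes s :: "'b \<Rightarrow> 'b::comm_monoid_add"
  assumes P: "P 0" "\<And>x y. P x \<Longrightarrow> P y \<Longrightarrow> P (x + y)" "\<And>x. P x \<Longrightarrow> P (s x)"
    and "\<And>d. d \<in> lists (gen_indices m) \<Longrightarrow> P (f d)"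
    and "w \<in> lists (quon_gens m)" "c \<in> lists (gen_indices m)"
  shows "P (dual_word s m w f c)"
  using assms(4-)
proof (induction w arbitrary: f rule: list.induct)
  case (Cons g w)
  have "P (dual_gen s m g f d)" if d: "d \<in> lists (gen_indices m)" for d
  proof (cases g)
    case (Ann i k)
    have "P (contract s m (i, k) f d)"
    proof (rule contract_closed[where P = P, OF P])
      show "P (f d')" if "set d' \<subseteq> set d" for d'
        using that d by (intro Cons.prems(1)) auto
    qed
    then show ?thesis using Ann by simp
  next
    case (Cre i k)
    then show ?thesis using d Cons.prems by auto
  qed
  then show ?case using Cons.IH[of "dual_gen s m g f"] Cons.prems by simp
qed simp

text \<open>Each annihilator deletes a letter of \<open>c\<close> or gives 0, so nothing longer than
  the empty word can survive and only \<open>f []\<close> is consulted.\<close>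

lemma dual_word_annihilate_short:
  assumes "length c \<le> length u"
  shows "dual_word s m (dag_word (cre_word u)) f c =
    dual_word s m (dag_word (cre_word u)) (\<lambda>d. if d = [] then f [] else 0) c"
  using assms
proof (induction u arbitrary: c)
  case (Cons a u)
  then show ?case by (auto intro!: contract_cong)
qed simp

lemma linear_twist_scaleR: "linear_twist ((*\<^sub>R) q :: 'v \<Rightarrow> 'v::real_vector)"
  by standard (simp_all add: scaleR_right_distrib)

lemma funpow_scaleR: "((*\<^sub>R) q ^^ n) x = q ^ n *\<^sub>R (x::'v::real_vector)"
  by (induction n) simp_all

locale fock_rep =
  fixes q :: real and m :: nat and ann cre :: "nat \<Rightarrow> nat \<Rightarrow> 'v::real_vector \<Rightarrow> 'v" and vac :: 'v
  assumes fock_like_rep: "fock_like_rep q m ann cre vac"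
    and m: "m \<ge> 1" and q: "-1 < q" "q < 1" "1 + (real m - 1) * q > 0"
begin

abbreviation "op_word w \<equiv> foldr (gen_op ann cre) w"

definition state :: "(nat \<times> nat) list \<Rightarrow> 'v" where
  "state c = op_word (cre_word c) vac"

abbreviation W where "W \<equiv> lists (gen_indices m)"

lemma state_Nil [simp]: "state [] = vac"
  by (simp add: state_def)

lemma vac_nonzero: "vac \<noteq> 0"
  and linear_ann: "(i, k) \<in> gen_indices m \<Longrightarrow> linear (ann i k)"
  and linear_cre: "(i, k) \<in> gen_indices m \<Longrightarrow> linear (cre i k)"
  and ann_vac: "(i, k) \<in> gen_indices m \<Longrightarrow> ann i k vac = 0"
  and ann_cre: "(i, k) \<in> gen_indices m \<Longrightarrow> (j, l) \<in> gen_indices m \<Longrightarrow>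
    ann j l (cre i k x) = q *\<^sub>R cre i k (ann j l x) + (q ^ qbeta m k l * (if i = j then 1 else 0)) *\<^sub>R x"
proof -
  have lin: "\<forall>(i, k)\<in>gen_indices m. linear (ann i k) \<and> linear (cre i k)"
    and rel: "\<forall>(i, k)\<in>gen_indices m. \<forall>(j, l)\<in>gen_indices m. \<forall>v. ann j l (cre i k v) =
          q *\<^sub>R cre i k (ann j l v) + (q ^ qbeta m k l * (if i = j then 1 else 0)) *\<^sub>R v"
    and vac: "\<forall>(i, k)\<in>gen_indices m. ann i k vac = 0"
    using fock_like_rep unfolding fock_like_rep_def by - (elim conjE, assumption)+
  show "vac \<noteq> 0"
    using fock_like_rep unfolding fock_like_rep_def by (elim conjE)
  show "linear (ann i k)" "linear (cre i k)" "ann i k vac = 0" if "(i, k) \<in> gen_indices m"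
    using bspec[OF lin that] bspec[OF vac that] by simp_all
  show "ann j l (cre i k x) = q *\<^sub>R cre i k (ann j l x) + (q ^ qbeta m k l * (if i = j then 1 else 0)) *\<^sub>R x"
    if "(i, k) \<in> gen_indices m" "(j, l) \<in> gen_indices m"
    using bspec[OF bspec[OF rel that(1), unfolded prod.case] that(2)] by simp
qed

lemma linear_op_word: "w \<in> lists (quon_gens m) \<Longrightarrow> linear (op_word w)"
proof (induction w rule: list.induct)
  case Nil
  then show ?case using linear_id by (simp add: id_def)
next
  case (Cons g w)
  have "linear (gen_op ann cre g)"
    using linear_ann linear_cre Cons.prems by (cases g) auto
  then show ?case using Cons linear_compose[of "op_word w" "gen_op ann cre g"] by (simp add: comp_def)
qed

lemma op_word_vac:
  assumes w: "w \<in> lists (quon_gens m)"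
  shows "op_word w vac = dual_word ((*\<^sub>R) q) m w state []"
  unfolding state_def
proof (rule linear_twist.dual_word_normal_order[OF linear_twist_scaleR _ _ w])
  fix u v i k j l
  assume u: "u \<in> lists (quon_gens m)"
    and ik: "(i, k) \<in> gen_indices m" and jl: "(j, l) \<in> gen_indices m"
  interpret linear "op_word u" by (rule linear_op_word[OF u])
  show "op_word (u @ Ann j l # Cre i k # v) vac = q *\<^sub>R op_word (u @ Cre i k # Ann j l # v) vac +
      (if i = j then ((*\<^sub>R) q ^^ qbeta m k l) (op_word (u @ v) vac) else 0)"
    by (simp add: ann_cre[OF ik jl] add scale funpow_scaleR)
next
  fix u j l assume u: "u \<in> lists (quon_gens m)" and jl: "(j, l) \<in> gen_indices m"
  then show "op_word (u @ [Ann j l]) vac = 0"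
    using linear_0[OF linear_op_word[OF u]] by (simp add: ann_vac)
qed

lemma linear_op_word_vac:
  assumes "linear h" "w \<in> lists (quon_gens m)"
  shows "h (op_word w vac) = dual_word ((*) q) m w (\<lambda>c. h (state c)) []"
  unfolding op_word_vac[OF assms(2)]
  by (rule dual_word_hom) (use assms(1) in \<open>auto simp: linear_0 linear_add linear_cmul\<close>)

text \<open>The abstract Gram matrix becomes visible inside an arbitrary representation, although
  \<open>V\<close> has no form: up to degree \<open>length u\<close> only multiples of the vacuum
  remain.\<close>

lemma annihilate_state:
  assumes u: "u \<in> W" and c: "c \<in> W" and len: "length c \<le> length u"
  shows "op_word (dag_word (cre_word u)) (state c) = gram q m u c *\<^sub>R vac"
proof -
  have "op_word (dag_word (cre_word u)) (state c) = op_word (dag_word (cre_word u) @ cre_word c) vac"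
    by (simp add: state_def)
  also have "\<dots> = dual_word ((*\<^sub>R) q) m (dag_word (cre_word u)) state c"
    using u c by (subst op_word_vac) (simp_all add: dual_word_cre_word)
  also have "\<dots> = dual_word ((*\<^sub>R) q) m (dag_word (cre_word u)) (\<lambda>d. (if d = [] then 1 else 0) *\<^sub>R vac) c"
    unfolding dual_word_annihilate_short[OF len, of _ _ state] by (simp add: if_distrib[of "\<lambda>r. r *\<^sub>R vac"] cong: if_cong)
  also have "\<dots> = gram q m u c *\<^sub>R vac"
    unfolding gram_eq_dual_word
    by (rule dual_word_hom[symmetric, of "\<lambda>r. r *\<^sub>R vac"]) (simp_all add: scaleR_left_distrib)
  finally show ?thesis .
qed

text \<open>Annihilating with the longest words that occur picks out the top-degree part of a relation.\<close>

lemma state_combination_zero: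
  assumes F: "finite F" "F \<subseteq> W" and relation: "(\<Sum>c\<in>F. r c *\<^sub>R state c) = 0" and "c \<in> F"
  shows "r c = 0"
proof (rule ccontr)
  assume "r c \<noteq> 0"
  define n where "n = Max (length ` {c \<in> F. r c \<noteq> 0})"
  have fin: "finite (length ` {c \<in> F. r c \<noteq> 0})" using F by simp
  have n_max: "length c \<le> n" if "c \<in> F" "r c \<noteq> 0" for c
    unfolding n_def using fin that by (intro Max_ge) auto
  have "n \<in> length ` {c \<in> F. r c \<noteq> 0}"
    unfolding n_def using fin \<open>c \<in> F\<close> \<open>r c \<noteq> 0\<close> by (intro Max_in) auto
  then obtain d where d: "d \<in> F" "r d \<noteq> 0" "length d = n" by auto
  \<comment> \<open>The top-degree part of the relation. It is nonzero at \<open>d\<close>, yet it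
    turns out to be annihilated by the Gram matrix, against strict positivity.\<close>
  define c' where "c' u = (if length u = n then r u else 0)" for u
  have top: "(\<Sum>w\<in>F. c' w * gram q m u w) = 0" if u: "u \<in> F" "length u = n" for u
  proof -
    have uW: "u \<in> W" using u F by auto
    interpret linear "op_word (dag_word (cre_word u))"
      by (rule linear_op_word) (use uW in simp)
    have "0 = op_word (dag_word (cre_word u)) (\<Sum>w\<in>F. r w *\<^sub>R state w)"
      by (simp add: relation zero)
    also have "\<dots> = (\<Sum>w\<in>F. r w *\<^sub>R op_word (dag_word (cre_word u)) (state w))"
      by (simp add: sum scale)
    also have "\<dots> = (\<Sum>w\<in>F. (c' w * gram q m u w) *\<^sub>R vac)"
    proof (intro sum.cong refl)
      fix w assume w: "w \<in> F"
      show "r w *\<^sub>R op_word (dag_word (cre_word u)) (state w) = (c' w * gram q m u w) *\<^sub>R vac"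
      \<comment> \<open>\<open>F\<close> may contain words longer than \<open>n\<close>, but only
        with coefficient 0; for the others \<open>annihilate_state\<close> applies.\<close>
      proof (cases "r w = 0")
        case False
        then have "length w \<le> length u" using n_max[OF w] u by simp
        then show ?thesis
          using annihilate_state[OF uW, of w] gram_length[of u w q m] subsetD[OF F(2) w] u(2)
          by (cases "length w = n") (simp_all add: c'_def)
      qed (simp add: c'_def)
    qed
    finally have "(\<Sum>w\<in>F. c' w * gram q m u w) *\<^sub>R vac = 0"
      by (simp add: scaleR_sum_left)
    then show ?thesis using vac_nonzero by simp
  qed
  have "(\<Sum>u\<in>F. \<Sum>w\<in>F. c' u * c' w * gram q m u w) = (\<Sum>u\<in>F. c' u * (\<Sum>w\<in>F. c' w * gram q m u w))"
    by (simp add: sum_distrib_left mult.assoc)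
  also have "\<dots> = 0"
    by (rule sum.neutral) (auto simp: c'_def top[unfolded c'_def])
  finally show False
    using pos_def_onD[OF gram_pos_def_on[OF m q F] d(1), of c'] d by (simp add: c'_def)
qed

lemma inj_on_state: "inj_on state W"
proof (rule inj_onI, rule ccontr)
  fix c d assume "c \<in> W" "d \<in> W" "state c = state d" "c \<noteq> d"
  then show False
    using state_combination_zero[of "{c, d}" "\<lambda>x. if x = c then 1 else -1" c] by simp
qed

lemma image_subset_state:
  assumes "T \<subseteq> state ` W" "finite T"
  obtains F where "F \<subseteq> W" "finite F" "T = state ` F" "inj_on state F"
proof -
  obtain F where F: "F \<subseteq> W" "T = state ` F" using assms(1) by (auto simp: subset_image_iff)
  then have "inj_on state F" using inj_on_state inj_on_subset by blast
  then show ?thesis using that F assms(2) finite_imageD by blast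
qed

lemma independent_state: "independent (state ` W)"
  unfolding independent_explicit_finite_subsets
proof (intro allI impI)
  fix T and r :: "'v \<Rightarrow> real"
  assume T: "T \<subseteq> state ` W" "finite T" and zero: "(\<Sum>v\<in>T. r v *\<^sub>R v) = 0"
  obtain F where F: "F \<subseteq> W" "finite F" "T = state ` F" "inj_on state F"
    using image_subset_state[OF T] .
  have "(\<Sum>c\<in>F. r (state c) *\<^sub>R state c) = 0"
    using zero F by (simp add: sum.reindex)
  then show "\<forall>v\<in>T. r v = 0"
    using state_combination_zero[OF F(2,1), of "\<lambda>c. r (state c)"] F(3) by blast
qed

section \<open>The Fock space and its inner product\<close>

definition S :: "'v set" where
  "S = span (state ` W)"

lemma state_in_S: "c \<in> W \<Longrightarrow> state c \<in> S"
  unfolding S_def by (intro span_base) auto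

lemma subspace_S: "subspace S"
  by (simp add: S_def)

lemma S_expansion:
  assumes "x \<in> S"
  obtains F r where "F \<subseteq> W" "finite F" "x = (\<Sum>c\<in>F. r c *\<^sub>R state c)"
proof -
  obtain T r where T: "finite T" "T \<subseteq> state ` W" "x = (\<Sum>v\<in>T. r v *\<^sub>R v)"
    using assms unfolding S_def span_explicit by blast
  obtain F where F: "F \<subseteq> W" "finite F" "T = state ` F" "inj_on state F"
    using image_subset_state[OF T(2,1)] .
  show ?thesis
    using that[of F "\<lambda>c. r (state c)"] F T(3) by (simp add: sum.reindex)
qed

lemma op_word_in_S:
  assumes "w \<in> lists (quon_gens m)"
  shows "op_word w vac \<in> S"
  unfolding op_word_vac[OF assms]
  by (rule dual_word_closed[where P = "\<lambda>x. x \<in> S"])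
    (use assms in \<open>auto simp: state_in_S subspace_S intro: subspace_0 subspace_add subspace_scale\<close>)

lemma act_in_S:
  assumes "a \<in> regular_alg q m"
  shows "act q ann cre a vac \<in> S"
  unfolding act_def using assms
  by (intro subspace_sum subspace_scale subspace_S op_word_in_S)
    (auto simp: regular_alg_def dest: free_alg_keysD)

lemma fock_space_eq: "fock_space q m ann cre vac = S"
proof (intro equalityI subsetI)
  fix x assume "x \<in> S"
  then obtain F r where F: "F \<subseteq> W" "finite F" and x: "x = (\<Sum>c\<in>F. r c *\<^sub>R state c)"
    by (rule S_expansion)
  \<comment> \<open>Real coefficients are realised by constant rational functions, which have no
    poles.\<close>
  define a :: quon_poly where "a = (\<Sum>c\<in>F. Poly_Mapping.single (cre_word c) (Fract [:r c:] 1))"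
  have inj: "inj cre_word"
    unfolding cre_word_def by (intro inj_mapI) (auto simp: inj_def)
  have lookup: "Poly_Mapping.lookup a (cre_word c) = (if c \<in> F then Fract [:r c:] 1 else 0)" for c
    using F inj by (simp add: a_def lookup_sum lookup_single when_def inj_eq)
  have out: "Poly_Mapping.lookup a w = 0" if "w \<notin> cre_word ` F" for w
    using that by (auto simp: a_def lookup_sum lookup_single when_def intro!: sum.neutral)
  have "act q ann cre a vac = (\<Sum>w\<in>cre_word ` F. eval_at q (Poly_Mapping.lookup a w) *\<^sub>R op_word w vac)"
    unfolding act_def using F out by (intro sum.mono_neutral_left) (auto simp: in_keys_iff intro: ccontr)
  also have "\<dots> = x"
    unfolding x by (subst sum.reindex) (auto simp: lookup state_def inj_on_subset[OF inj])
  finally have "act q ann cre a vac = x" .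
  moreover have "a \<in> regular_alg q m"
  proof -
    have "a \<in> free_alg m"
      unfolding a_def using F by (intro free_alg_sum free_alg_single) auto
    moreover have "regular_at q (Poly_Mapping.lookup a w)" for w
      using out[of w] lookup by (cases "w \<in> cre_word ` F") auto
    ultimately show ?thesis by (simp add: regular_alg_def)
  qed
  ultimately show "x \<in> fock_space q m ann cre vac" unfolding fock_space_def by blast
qed (auto simp: fock_space_def act_in_S)

text \<open>Independence of the states allows a linear functional to be prescribed on them. This is
  done twice: \<open>g c\<close> extends row \<open>c\<close> of the Gram matrix, then
  \<open>\<psi> y\<close> extends \<open>g c y\<close> as a function of \<open>c\<close>. Linearity
  on the right is thus obtained only when the left argument is a state.\<close>

lemma fock_form_exists:
  obtains B :: "'v \<Rightarrow> 'v \<Rightarrow> real" where "\<And>y. linear (\<lambda>x. B x y)" "\<And>c. c \<in> W \<Longrightarrow> linear (B (state c))"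
    "\<And>c d. c \<in> W \<Longrightarrow> d \<in> W \<Longrightarrow> B (state c) (state d) = gram q m c d"
proof -
  have extend: "\<exists>h. linear h \<and> (\<forall>c\<in>W. h (state c) = g c)" for g :: "_ \<Rightarrow> real"
  proof -
    obtain h :: "'v \<Rightarrow> real" where h: "linear h" "\<forall>x\<in>state ` W. h x = g (inv_into W state x)"
      using linear_independent_extend[OF independent_state, where f = "\<lambda>x. g (inv_into W state x)"]
      by (elim exE conjE)
    have "h (state c) = g c" if "c \<in> W" for c
      using bspec[OF h(2) imageI[OF that]] inj_on_state that by simp
    then show ?thesis using h(1) by blast
  qed
  have "\<forall>c. \<exists>h. linear h \<and> (\<forall>d\<in>W. h (state d) = gram q m c d)" by (intro allI extend)
  then obtain g where g: "\<And>c. linear (g c)" "\<And>c d. d \<in> W \<Longrightarrow> g c (state d) = gram q m c d"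
    by metis
  have "\<forall>y. \<exists>h. linear h \<and> (\<forall>c\<in>W. h (state c) = g c y)" by (intro allI extend)
  then obtain \<psi> where \<psi>: "\<And>y. linear (\<psi> y)" "\<And>y c. c \<in> W \<Longrightarrow> \<psi> y (state c) = g c y"
    by metis
  show ?thesis
  proof (rule that[of "\<lambda>x y. \<psi> y x"])
    show "linear (\<lambda>x. \<psi> y x)" for y by (rule \<psi>)
    show "linear (\<lambda>y. \<psi> y (state c))" if "c \<in> W" for c using \<psi>(2)[OF that] g(1)[of c] by simp
    show "\<psi> (state d) (state c) = gram q m c d" if "c \<in> W" "d \<in> W" for c d
      using that by (simp add: \<psi> g)
  qed
qed

lemma fock_form:
  obtains B :: "'v \<Rightarrow> 'v \<Rightarrow> real" where "inner_product_on S B"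
    "\<And>u w. u \<in> lists (quon_gens m) \<Longrightarrow> w \<in> lists (quon_gens m) \<Longrightarrow>
      B (op_word u vac) (op_word w vac) = vacuum_value q m (dag_word u @ w)"
proof -
  obtain B where B1: "\<And>y. linear (\<lambda>x. B x y)" and B2: "\<And>c. c \<in> W \<Longrightarrow> linear (B (state c))"
    and B_state: "\<And>c d. c \<in> W \<Longrightarrow> d \<in> W \<Longrightarrow> B (state c) (state d) = gram q m c d"
    using fock_form_exists by blast
  \<comment> \<open>Both sides are linear in \<open>x\<close> and agree on the states, hence on
    their span.\<close>
  have add_right: "B x (y + z) = B x y + B x z" if "x \<in> S" for x y z
  proof -
    have "linear (\<lambda>x. B x y + B x z)" by (intro linear_compose_add B1)
    then show ?thesis
      using linear_eq_on_span[OF B1[of "y + z"], of "\<lambda>x. B x y + B x z" "state ` W" x] that linear_add[OF B2]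
      by (auto simp: S_def)
  qed
  have scale_right: "B x (r *\<^sub>R y) = r * B x y" if "x \<in> S" for x y r
  proof -
    have "linear (\<lambda>x. r *\<^sub>R B x y)" by (rule linear_compose_scale_right[OF B1])
    then show ?thesis
      using linear_eq_on_span[OF B1[of "r *\<^sub>R y"], of "\<lambda>x. r *\<^sub>R B x y" "state ` W" x] that linear_cmul[OF B2]
      by (auto simp: S_def)
  qed
  have lin_right: "linear (B x)" if "x \<in> S" for x
    using add_right[OF that] scale_right[OF that] by (intro linearI) auto
  have sym_state: "B (state c) y = B y (state c)" if "c \<in> W" "y \<in> S" for c y
  proof (rule linear_eq_on_span[OF B2[OF that(1)] B1[of "state c"], of "state ` W" y])
    show "B (state c) x = B x (state c)" if x: "x \<in> state ` W" for x
    proof -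
      obtain d where d: "x = state d" "d \<in> W" using x by blast
      show ?thesis
        unfolding d(1) B_state[OF \<open>c \<in> W\<close> d(2)] B_state[OF d(2) \<open>c \<in> W\<close>]
        by (rule gram_sym[OF \<open>c \<in> W\<close> d(2)])
    qed
  qed (use that in \<open>simp add: S_def\<close>)
  have sym: "B x y = B y x" if "x \<in> S" "y \<in> S" for x y
  proof (rule linear_eq_on_span[OF lin_right[OF that(1)] B1[of x], of "state ` W" y])
    show "B x v = B v x" if "v \<in> state ` W" for v
    proof -
      obtain d where d: "v = state d" "d \<in> W" using \<open>v \<in> state ` W\<close> by blast
      show ?thesis unfolding d(1) by (rule sym_state[OF d(2) \<open>x \<in> S\<close>, symmetric])
    qed
  qed (use that in \<open>simp add: S_def\<close>)
  have pos: "B x x > 0" if x: "x \<in> S" "x \<noteq> 0" for x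
  proof -
    obtain F r where F: "F \<subseteq> W" "finite F" and xr: "x = (\<Sum>c\<in>F. r c *\<^sub>R state c)"
      using S_expansion[OF x(1)] .
    have "B x x = (\<Sum>c\<in>F. r c * B (state c) x)"
      by (subst (1) xr) (simp add: linear_sum[OF B1] linear_cmul[OF B1])
    also have "\<dots> = (\<Sum>c\<in>F. \<Sum>d\<in>F. r c * r d * gram q m c d)"
    proof (intro sum.cong refl)
      fix c assume "c \<in> F"
      then have c: "c \<in> W" using F by auto
      have "B (state c) x = (\<Sum>d\<in>F. r d * B (state c) (state d))"
        unfolding xr by (simp add: linear_sum[OF B2[OF c]] linear_cmul[OF B2[OF c]])
      also have "\<dots> = (\<Sum>d\<in>F. r d * gram q m c d)"
        by (intro sum.cong refl arg_cong2[where f = "(*)"] B_state[OF c]) (use F(1) in blast)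
      finally show "r c * B (state c) x = (\<Sum>d\<in>F. r c * r d * gram q m c d)"
        by (simp add: sum_distrib_left mult.assoc)
    qed
    finally have eq: "B x x = (\<Sum>c\<in>F. \<Sum>d\<in>F. r c * r d * gram q m c d)" .
    have "\<exists>c\<in>F. r c \<noteq> 0" using x(2) xr by (auto intro: sum.neutral)
    then show ?thesis
      unfolding eq using pos_def_onD[OF gram_pos_def_on[OF m q F(2,1)]] by blast
  qed
  have words: "B (op_word u vac) (op_word w vac) = vacuum_value q m (dag_word u @ w)"
    if u: "u \<in> lists (quon_gens m)" and w: "w \<in> lists (quon_gens m)" for u w
  proof -
    \<comment> \<open>Normal ordering is applied first on the right, against a state on the left,
      and then on the left.\<close>
    have state: "B (state c) (op_word w vac) = vacuum_value q m (dag_word (cre_word c) @ w)" if c: "c \<in> W" for c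
    proof -
      have "B (state c) (op_word w vac) = dual_word ((*) q) m w (\<lambda>d. B (state c) (state d)) []"
        by (rule linear_op_word_vac[OF B2[OF c] w])
      also have "\<dots> = dual_word ((*) q) m w (gram q m c) []"
        by (rule dual_word_cong[OF w]) (simp, rule B_state[OF c])
      finally show ?thesis by (simp add: gram_eq_dual_word vacuum_value_def)
    qed
    have "B (op_word u vac) (op_word w vac) = dual_word ((*) q) m u (\<lambda>c. B (state c) (op_word w vac)) []"
      by (rule linear_op_word_vac[OF B1 u])
    also have "\<dots> = dual_word ((*) q) m u (\<lambda>c. vacuum_value q m (dag_word (cre_word c) @ w)) []"
      by (rule dual_word_cong[OF u]) (simp, rule state)
    finally show ?thesis using vacuum_value_dag_left[OF u, of q w] by simp
  qed
  have "inner_product_on S B"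
    unfolding inner_product_on_def
    using subspace_S linear_add[OF B1] linear_cmul[OF B1] sym pos by auto
  then show ?thesis using that words by blast
qed

text \<open>There are countably many states, and infinitely many because the powers of the creator
  with index (1, 1) already give distinct ones.\<close>

lemma state_enumeration:
  obtains e :: "nat \<Rightarrow> 'v" where "inj e" "range e = state ` W"
proof -
  have "infinite W"
  proof
    assume "finite W"
    moreover have "range (\<lambda>n. replicate n (1, 1)) \<subseteq> W" using m by (auto simp: gen_indices_def)
    moreover have "inj (\<lambda>n. replicate n (1::nat, 1::nat))" by (auto simp: inj_def)
    ultimately show False using finite_subset finite_imageD infinite_UNIV_nat by metis
  qed
  then have "infinite (state ` W)" using finite_imageD[OF _ inj_on_state] by blast
  moreover have "countable (state ` W)" by simp
  ultimately have "bij_betw (from_nat_into (state ` W)) UNIV (state ` W)"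
    by (simp add: bij_betw_from_nat_into)
  then show ?thesis using that by (auto simp: bij_betw_def)
qed

lemma fock_space_pre_hilbert:
  obtains B :: "'v \<Rightarrow> 'v \<Rightarrow> real" where "pre_hilbert_on (fock_space q m ann cre vac) B"
    "\<And>a b. a \<in> regular_alg q m \<Longrightarrow> b \<in> regular_alg q m \<Longrightarrow>
      B (act q ann cre a vac) (act q ann cre b vac) = eval_at q (vac_exp m (dag a * b))"
proof -
  obtain B where B: "inner_product_on S B"
    and words: "\<And>u w. u \<in> lists (quon_gens m) \<Longrightarrow> w \<in> lists (quon_gens m) \<Longrightarrow>
      B (op_word u vac) (op_word w vac) = vacuum_value q m (dag_word u @ w)"
    using fock_form by blast
  interpret inner_product S B by standard (rule B)
  obtain e :: "nat \<Rightarrow> 'v" where e: "inj e" "range e = state ` W" by (rule state_enumeration)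
  have "pre_hilbert_on S B"
    using e independent_state by (intro pre_hilbert_on_span[of e]) (auto simp: S_def)
  moreover have "B (act q ann cre a vac) (act q ann cre b vac) = eval_at q (vac_exp m (dag a * b))"
    if a: "a \<in> regular_alg q m" and b: "b \<in> regular_alg q m" for a b
  proof -
    have keys: "\<And>w. w \<in> Poly_Mapping.keys a \<Longrightarrow> w \<in> lists (quon_gens m)"
      "\<And>w. w \<in> Poly_Mapping.keys b \<Longrightarrow> w \<in> lists (quon_gens m)"
      using a b by (auto simp: regular_alg_def dest: free_alg_keysD)
    have "B (act q ann cre a vac) (act q ann cre b vac) =
      (\<Sum>u\<in>Poly_Mapping.keys a. eval_at q (Poly_Mapping.lookup a u) * B (op_word u vac) (act q ann cre b vac))"
      unfolding act_def[of q ann cre a] using keys(1)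
      by (intro B_sum op_word_in_S act_in_S[OF b]) auto
    also have "\<dots> = (\<Sum>u\<in>Poly_Mapping.keys a. eval_at q (Poly_Mapping.lookup a u) *
       (\<Sum>w\<in>Poly_Mapping.keys b. eval_at q (Poly_Mapping.lookup b w) * vacuum_value q m (dag_word u @ w)))"
    proof (intro sum.cong refl arg_cong2[where f = "(*)"])
      fix u assume u: "u \<in> Poly_Mapping.keys a"
      have "B (op_word u vac) (act q ann cre b vac) =
        (\<Sum>w\<in>Poly_Mapping.keys b. eval_at q (Poly_Mapping.lookup b w) * B (op_word u vac) (op_word w vac))"
        unfolding act_def using keys u by (intro B_sum_right op_word_in_S) auto
      then show "B (op_word u vac) (act q ann cre b vac) =
        (\<Sum>w\<in>Poly_Mapping.keys b. eval_at q (Poly_Mapping.lookup b w) * vacuum_value q m (dag_word u @ w))"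
        using keys u by (simp add: words)
    qed
    finally show ?thesis
      by (simp add: regular_at_vac_exp(2)[OF a b] sum_distrib_left mult.assoc)
  qed
  ultimately show ?thesis using that by (simp add: fock_space_eq)
qed

end

theorem theorem1p1:
  fixes m :: nat and q :: real
    and ann cre :: "nat \<Rightarrow> nat \<Rightarrow> 'v::real_vector \<Rightarrow> 'v" and vac :: 'v
  assumes "m \<ge> 1"
    and "m = 1 \<Longrightarrow> -1 < q \<and> q < 1"
    and "m > 1 \<Longrightarrow> 1 / (1 - real m) < q \<and> q < 1"
    and "fock_like_rep q m ann cre vac"
  shows "(\<exists>!\<phi>. is_vacuum_expectation m \<phi>) \<and>
    (\<exists>B :: 'v \<Rightarrow> 'v \<Rightarrow> real.
       (\<forall>a\<in>regular_alg q m. \<forall>b\<in>regular_alg q m.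
          regular_at q (vac_exp m (dag a * b)) \<and>
          B (act q ann cre a vac) (act q ann cre b vac) = eval_at q (vac_exp m (dag a * b))) \<and>
       pre_hilbert_on (fock_space q m ann cre vac) B)"
proof -
  \<comment> \<open>Both cases are brought to one form. For \<open>m > 1\<close> the bound
    \<open>-1 < q\<close> follows from \<open>1 / (m - 1) \<le> 1\<close>.\<close>
  have q: "-1 < q \<and> q < 1 \<and> 1 + (real m - 1) * q > 0"
  proof (cases "m = 1")
    case False
    then have m: "real m - 1 \<ge> 1" and *: "1 / (1 - real m) < q" "q < 1" using assms(1,3) by auto
    have "- (1 / (real m - 1)) < q" using *(1) by (metis minus_diff_eq minus_divide_right)
    then have "- 1 < q * (real m - 1)" using m by (simp add: field_simps)
    moreover have "1 / (real m - 1) \<le> 1" using m by simp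
    ultimately show ?thesis using * \<open>- (1 / (real m - 1)) < q\<close> by (simp add: mult.commute)
  qed (use assms(2) in simp)
  interpret fock_rep q m ann cre vac
    by standard (use assms q in auto)
  obtain B where "pre_hilbert_on (fock_space q m ann cre vac) B"
    "\<And>a b. a \<in> regular_alg q m \<Longrightarrow> b \<in> regular_alg q m \<Longrightarrow>
      B (act q ann cre a vac) (act q ann cre b vac) = eval_at q (vac_exp m (dag a * b))"
    using fock_space_pre_hilbert by blast
  moreover have "\<exists>!\<phi>. is_vacuum_expectation m \<phi>"
    using is_vacuum_expectation_quon_vacuum vacuum_expectation_unique by metis
  ultimately show ?thesis using regular_at_vac_exp(1) by blast
qed

end
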